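(* Let $G$ be a meta-$\mathfrak{Nil}$-Hamiltonian group. If $G$ is soluble-by-finite, then $G$ is a $\mathcal{W}$-group.
   Context: A group $G$ is meta-$\mathfrak{Nil}$-Hamiltonian if every non-nilpotent subgroup of $G$ is normal in $G$. A group $G$ is a $\mathcal{W}$-group if every finitely generated non-nilpotent subgroup of $G$ has a finite non-nilpotent homomorphic image. $G$ is soluble-by-finite if it has a soluble normal subgroup of finite index. *)

theory Defs
  imports "HOL-Algebra.Algebra"
begin

definition commutator_set :: "('a, 'b) monoid_scheme \<Rightarrow> 'a set \<Rightarrow> 'a set \<Rightarrow> 'a set" where
  "commutator_set G A B =
     (\<Union>a\<in>A. \<Union>b\<in>B. {a \<otimes>\<^bsub>G\<^esub> b \<otimes>\<^bsub>G\<^esub> inv\<^bsub>G\<^esub> a \<otimes>\<^bsub>G\<^esub> inv\<^bsub>G\<^esub> b})"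

fun lower_central :: "('a, 'b) monoid_scheme \<Rightarrow> nat \<Rightarrow> 'a set" where
  "lower_central G 0 = carrier G"
| "lower_central G (Suc n) = generate G (commutator_set G (lower_central G n) (carrier G))"

definition nilpotent_group :: "('a, 'b) monoid_scheme \<Rightarrow> bool" where
  "nilpotent_group G \<longleftrightarrow> group G \<and> (\<exists>n. lower_central G n = {\<one>\<^bsub>G\<^esub>})"

definition meta_Nil_Hamiltonian :: "('a, 'b) monoid_scheme \<Rightarrow> bool" where
  "meta_Nil_Hamiltonian G \<longleftrightarrow> group G \<and>
     (\<forall>H. subgroup H G \<and> \<not> nilpotent_group (G\<lparr>carrier := H\<rparr>) \<longrightarrow> H \<lhd> G)"

text \<open>Every finitely generated non-nilpotent subgroup has a finite non-nilpotent
  homomorphic image.  Homomorphic images are taken with codomain of type \<open>'a set monoid\<close>,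
  which contains (an isomorphic copy, namely the quotient) of every homomorphic image.\<close>
definition W_group :: "('a, 'b) monoid_scheme \<Rightarrow> bool" where
  "W_group G \<longleftrightarrow> group G \<and>
     (\<forall>S. finite S \<and> S \<subseteq> carrier G \<and> \<not> nilpotent_group (subgroup_generated G S) \<longrightarrow>
        (\<exists>(K :: 'a set monoid) f. group K \<and> f \<in> hom (subgroup_generated G S) K \<and>
            f ` carrier (subgroup_generated G S) = carrier K \<and>
            finite (carrier K) \<and> \<not> nilpotent_group K))"

definition soluble_by_finite :: "('a, 'b) monoid_scheme \<Rightarrow> bool" where
  "soluble_by_finite G \<longleftrightarrow> group G \<and>
     (\<exists>N. N \<lhd> G \<and> solvable (G\<lparr>carrier := N\<rparr>) \<and> finite (rcosets\<^bsub>G\<^esub> N))"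

end

theory Submission
  imports Defs "HOL-Computational_Algebra.Primes" "HOL-Computational_Algebra.Polynomial"
begin

text \<open>
  Terms of the lower central series of a finitely generated group are normal closures of finite
  sets, so by Zorn's lemma a finitely generated non-nilpotent group has a quotient \<open>Q\<close> that is not
  nilpotent while all its proper quotients are. It suffices to show that \<open>Q\<close> is finite. If the
  soluble normal subgroup of finite index dies in \<open>Q\<close> this is clear; otherwise \<open>Q\<close> has a nontrivial
  abelian normal subgroup \<open>A\<close>. The centre of \<open>Q\<close> is trivial and nontrivial normal subgroups
  of \<open>Q\<close> meet nontrivially. Choosing \<open>x\<close> outside \<open>C(A)\<close> but central modulo \<open>C(A)\<close>, one finds that
  \<open>x\<close> acts without fixed points on \<open>A\<close>. Hence for \<open>1 \<noteq> a \<in> A\<close> the subgroup \<open>\<langle>x, a\<rangle>\<close> is not nilpotent,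
  so it is normal, and so is the cyclic \<open>\<int>[t, 1/t]\<close>-module \<open>M = \<langle>x, a\<rangle> \<inter> A\<close> generated by \<open>a\<close>, with \<open>t\<close>
  acting as conjugation by \<open>x\<close>. Every nonzero submodule of this kind contains a power of \<open>1 - t\<close>
  applied to \<open>a\<close>; applied to the submodule cut out by \<open>t\<^sup>2 - t + 1\<close> this gives a polynomial
  relation for \<open>a\<close>. If \<open>A\<close> is torsion-free, applying it to \<open>p M\<close> for a large prime \<open>p\<close> contradicts
  the minimality of a relation of least degree. If \<open>a\<close> has prime order, \<open>M\<close> is finite, a power of
  \<open>x\<close> centralises \<open>L = \<langle>x, a\<rangle>\<close>, and \<open>C(L) \<inter> M = 1\<close> forces \<open>C(L) = 1\<close>; so \<open>L\<close> is finite and \<open>Q\<close> embeds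
  into the automorphism group of \<open>L\<close>.
\<close>

section \<open>Divisibility of integer polynomials by primes\<close>

text \<open>Modulo \<open>p\<close> the polynomial \<open>h\<close> keeps positive degree, so it is
  not a unit and cannot divide a nonzero constant. The induction strips from \<open>q\<close> the
  leading terms that vanish modulo \<open>p\<close>.\<close>

lemma not_dvd_mult_minus_const:
  fixes p u :: int and h q :: "int poly"
  assumes p: "Factorial_Ring.prime p" and h: "\<not> p dvd lead_coeff h" "Polynomial.degree h \<ge> 1" and u: "\<not> p dvd u"
  shows "\<not> [:p:] dvd h * q - [:u:]"
proof (induction "Polynomial.degree q" arbitrary: q rule: less_induct)
  case less
  show ?case
  proof
    assume d: "[:p:] dvd h * q - [:u:]"
    have q0: "q \<noteq> 0"
      using d u by (auto simp: const_poly_dvd_iff coeff_pCons split: nat.splits)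
    let ?d = "Polynomial.degree h" and ?e = "Polynomial.degree q"
    \<comment> \<open>As \<open>h\<close> has positive degree, the constant does not reach this
      coefficient, which is therefore the product of the two leading coefficients.\<close>
    have "p dvd poly.coeff (h * q - [:u:]) (?d + ?e)"
      using d by (simp only: const_poly_dvd_iff)
    moreover have "poly.coeff [:u:] (?d + ?e) = 0"
      using h(2) by (simp add: coeff_pCons split: nat.splits)
    ultimately have "p dvd lead_coeff h * lead_coeff q"
      by (simp add: coeff_mult_degree_sum)
    then have pq: "p dvd lead_coeff q"
      using p h(1) by (auto simp: prime_dvd_mult_iff)
    show False
    proof (cases "?e = 0")
      case True
      then obtain c where c: "q = [:c:]" by (metis degree_eq_zeroE)
      have "[:p:] dvd h * q"
        using pq unfolding c by (intro dvd_mult) simp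
      then have "[:p:] dvd [:u:]" using d by (simp add: dvd_diff_right_iff dvd_diff_left_iff)
      then show False using u by simp
    next
      case False
      define q' where "q' = q - Polynomial.monom (lead_coeff q) ?e"
      have lt: "Polynomial.degree q' < ?e"
      proof (rule coeff_0_degree_minus_1[THEN le_less_trans])
        show "poly.coeff q' ?e = 0" by (simp add: q'_def)
        show "Polynomial.degree q' \<le> ?e" unfolding q'_def
          by (intro degree_diff_le) (simp_all add: degree_monom_le)
        show "?e - 1 < ?e" using False by simp
      qed
      have "[:p:] dvd h * Polynomial.monom (lead_coeff q) ?e"
        using pq by (intro dvd_mult) (auto simp: const_poly_dvd_iff)
      then have "[:p:] dvd (h * q - [:u:]) - h * Polynomial.monom (lead_coeff q) ?e"
        using d by (rule dvd_diff[rotated])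
      then have "[:p:] dvd h * q' - [:u:]"
        by (simp add: q'_def algebra_simps)
      then show False using less[OF lt] by blast
    qed
  qed
qed

text \<open>Modulo \<open>p\<close> neither 0 nor 1 is a root of \<open>h\<close>, so if
  \<open>h * q\<close> were congruent to \<open>u t^j (1 - t)^n\<close>, all factors
  \<open>t\<close> and \<open>1 - t\<close> would come from \<open>q\<close>. Cancelling them one at
  a time leaves the case of a constant.\<close>

lemma not_dvd_mult_minus_powers:
  fixes p u :: int and h q :: "int poly"
  assumes p: "Factorial_Ring.prime p" and h: "\<not> p dvd lead_coeff h" "Polynomial.degree h \<ge> 1"
    and u: "\<not> p dvd u"
    and h0: "\<not> p dvd poly h 0" and h1: "\<not> p dvd poly h 1"
  shows "\<not> [:p:] dvd h * q - Polynomial.smult u ([:0, 1:] ^ j * [:1, -1:] ^ n)"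
proof -
  have pp: "prime_elem [:p:]" using p by (intro lift_prime_elem_poly) auto
  \<comment> \<open>Evaluation at \<open>c\<close> gives \<open>p dvd poly q c\<close>, so
    \<open>[:-c, 1:]\<close> splits off \<open>q\<close> modulo \<open>p\<close>; it cancels because
    \<open>[:p:]\<close> is a prime element that does not divide it.\<close>
  have cancel: "\<exists>q'. [:p:] dvd h * q' - w"
    if d: "[:p:] dvd h * q - [:-c, 1:] * w" and c: "\<not> p dvd poly h c" for q w c
  proof -
    obtain k where k: "h * q - [:-c, 1:] * w = [:p:] * k" using d by blast
    have "poly (h * q - [:-c, 1:] * w) c = poly ([:p:] * k) c" using k by simp
    then have "p dvd poly h c * poly q c" by simp
    then have pq: "p dvd poly q c" using p c by (auto simp: prime_dvd_mult_iff)
    define q' where "q' = synthetic_div q c"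
    have q': "q = [:-c, 1:] * q' + [:poly q c:]"
      unfolding q'_def by (simp only: synthetic_div_correct')
    have "[:p:] dvd h * [:poly q c:]" using pq by (intro dvd_mult) simp
    then have "[:p:] dvd (h * q - [:-c, 1:] * w) - h * [:poly q c:]"
      using d by (rule dvd_diff[rotated])
    also have "(h * q - [:-c, 1:] * w) - h * [:poly q c:] = [:-c, 1:] * (h * q' - w)"
      by (subst q') (simp only: algebra_simps)
    finally have "[:p:] dvd [:-c, 1:] \<or> [:p:] dvd h * q' - w"
      using pp by (simp only: prime_elem_dvd_mult_iff)
    moreover have "\<not> [:p:] dvd [:-c, 1:]"
    proof
      assume "[:p:] dvd [:-c, 1:]"
      then have "p dvd poly.coeff [:-c, 1:] 1" by (simp only: const_poly_dvd_iff)
      then show False using p by (simp add: not_prime_unit)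
    qed
    ultimately show ?thesis by blast
  qed
  show ?thesis
    using u
  proof (induction j arbitrary: q)
    case 0
    then show ?case
    proof (induction n arbitrary: q u)
      case 0
      have "Polynomial.smult u ([:0, 1:] ^ 0 * [:1, -1:] ^ 0) = [:u:]" by simp
      then show ?case using not_dvd_mult_minus_const[OF p h 0] by simp
    next
      case (Suc n)
      \<comment> \<open>\<open>cancel\<close> expects monic linear factors, so the sign is absorbed
        into \<open>u\<close>; this is why the inner induction generalises \<open>u\<close>.\<close>
      have "[:1, -1:] = - [:-1, 1::int:]" by simp
      then have "Polynomial.smult u ([:0, 1:] ^ 0 * [:1, -1:] ^ Suc n)
          = [:-1, 1:] * Polynomial.smult (-u) ([:0, 1:] ^ 0 * [:1, -1:] ^ n)"
        by (simp only: power_Suc power_0 mult_1_left mult_smult_right mult_minus_left mult_minus_right smult_minus_left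
            smult_minus_right)
      moreover have "\<not> p dvd - u" using Suc.prems by simp
      ultimately show ?case
        using cancel[of q 1 "Polynomial.smult (-u) ([:0, 1:] ^ 0 * [:1, -1:] ^ n)"] h1
          Suc.IH[of "-u"] by auto
    qed
  next
    case (Suc j)
    have "Polynomial.smult u ([:0, 1:] ^ Suc j * [:1, -1:] ^ n)
        = [:-0, 1:] * Polynomial.smult u ([:0, 1:] ^ j * [:1, -1:] ^ n)"
      by (simp add: mult.assoc)
    then show ?case
      using cancel[of q 0 "Polynomial.smult u ([:0, 1:] ^ j * [:1, -1:] ^ n)"] h0 Suc.IH Suc.prems
      by auto
  qed
qed

section \<open>Conjugation as a module structure\<close>

lemma (in group) conj_hom:
  assumes g: "g \<in> carrier G"
  shows "(\<lambda>a. g \<otimes> a \<otimes> inv g) \<in> hom G G"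
proof (rule homI)
  fix a b assume ab: "a \<in> carrier G" "b \<in> carrier G"
  have "g \<otimes> a \<otimes> inv g \<otimes> (g \<otimes> b \<otimes> inv g) = g \<otimes> a \<otimes> (inv g \<otimes> g) \<otimes> b \<otimes> inv g"
    using g ab by (simp only: m_assoc m_closed inv_closed)
  then show "g \<otimes> (a \<otimes> b) \<otimes> inv g = g \<otimes> a \<otimes> inv g \<otimes> (g \<otimes> b \<otimes> inv g)"
    using g ab by (simp add: m_assoc)
qed (use g in simp)

locale conj_module = group G for G (structure) +
  fixes A x
  assumes A_normal: "A \<lhd> G"
    and A_comm: "\<lbrakk>a \<in> A; b \<in> A\<rbrakk> \<Longrightarrow> a \<otimes> b = b \<otimes> a"
    and x_closed [simp]: "x \<in> carrier G"
begin

lemma A_subgroup: "subgroup A G"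
  using A_normal by (rule normal_imp_subgroup)

lemma A_carrier [simp]: "a \<in> A \<Longrightarrow> a \<in> carrier G"
  using A_subgroup by (rule subgroup.mem_carrier)

lemma A_one [simp]: "\<one> \<in> A"
  using A_subgroup by (rule subgroup.one_closed)

lemma A_mult [simp]: "\<lbrakk>a \<in> A; b \<in> A\<rbrakk> \<Longrightarrow> a \<otimes> b \<in> A"
  using A_subgroup by (rule subgroup.m_closed)

lemma A_inv [simp]: "a \<in> A \<Longrightarrow> inv a \<in> A"
  using A_subgroup by (rule subgroup.m_inv_closed)

lemma A_int_pow [simp]: "a \<in> A \<Longrightarrow> a [^] (c::int) \<in> A"
  using A_subgroup by (simp add: subgroup_int_pow_closed)

lemma A_conj [simp]: "\<lbrakk>g \<in> carrier G; a \<in> A\<rbrakk> \<Longrightarrow> g \<otimes> a \<otimes> inv g \<in> A"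
  using A_normal by (simp add: normal.inv_op_closed2)

lemma A_left_comm: "\<lbrakk>a \<in> A; b \<in> A; c \<in> A\<rbrakk> \<Longrightarrow> a \<otimes> (b \<otimes> c) = b \<otimes> (a \<otimes> c)"
  by (metis A_carrier A_comm m_assoc)

lemmas A_ac = m_assoc A_comm A_left_comm

lemma A_int_pow_distrib: "\<lbrakk>a \<in> A; b \<in> A\<rbrakk> \<Longrightarrow> (a \<otimes> b) [^] (c::int) = a [^] c \<otimes> b [^] c"
  by (simp add: A_comm int_pow_mult_distrib)

definition sigma :: "'a \<Rightarrow> 'a" where
  "sigma a = x \<otimes> a \<otimes> inv x"

lemma sigma_closed [simp]: "a \<in> A \<Longrightarrow> sigma a \<in> A"
  by (simp add: sigma_def)

lemma sigma_hom: "sigma \<in> hom G G"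
  using conj_hom[OF x_closed] by (simp add: sigma_def[abs_def])

lemma sigma_one [simp]: "sigma \<one> = \<one>"
  by (simp add: sigma_def)

lemma sigma_mult: "\<lbrakk>a \<in> A; b \<in> A\<rbrakk> \<Longrightarrow> sigma (a \<otimes> b) = sigma a \<otimes> sigma b"
  using sigma_hom by (simp add: hom_mult)

lemma sigma_int_pow: "a \<in> A \<Longrightarrow> sigma (a [^] (c::int)) = sigma a [^] c"
  using hom_int_pow[OF sigma_hom] by (simp add: is_group)

lemma sigma_inv: "a \<in> A \<Longrightarrow> sigma (inv a) = inv (sigma a)"
  using group_hom.hom_inv[of G G sigma] sigma_hom
  by (simp add: group_hom_def group_hom_axioms_def is_group)

lemma sigma_inj: "\<lbrakk>a \<in> A; b \<in> A; sigma a = sigma b\<rbrakk> \<Longrightarrow> a = b"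
  by (simp add: sigma_def)

lemma sigma_funpow_closed [simp]: "a \<in> A \<Longrightarrow> (sigma ^^ j) a \<in> A"
  by (induction j) auto

lemma sigma_funpow_inj: "\<lbrakk>a \<in> A; b \<in> A; (sigma ^^ j) a = (sigma ^^ j) b\<rbrakk> \<Longrightarrow> a = b"
proof (induction j)
  case (Suc j)
  then show ?case using sigma_inj[of "(sigma ^^ j) a" "(sigma ^^ j) b"] by simp
qed simp

lemma sigma_funpow_mult:
  "\<lbrakk>a \<in> A; b \<in> A\<rbrakk> \<Longrightarrow> (sigma ^^ j) (a \<otimes> b) = (sigma ^^ j) a \<otimes> (sigma ^^ j) b"
  by (induction j) (auto simp: sigma_mult)

lemma sigma_funpow_int_pow: "a \<in> A \<Longrightarrow> (sigma ^^ j) (a [^] (c::int)) = (sigma ^^ j) a [^] c"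
  by (induction j) (auto simp: sigma_int_pow)

lemma sigma_funpow_eq: "a \<in> A \<Longrightarrow> (sigma ^^ j) a = x [^] j \<otimes> a \<otimes> inv (x [^] j)"
proof (induction j)
  case (Suc j)
  have "x [^] Suc j = x \<otimes> x [^] j" by (rule nat_pow_Suc2) simp
  then show ?case using Suc by (simp add: sigma_def inv_mult_group m_assoc del: nat_pow_Suc)
qed simp

text \<open>The action of \<open>\<int>[t]\<close> on \<open>A\<close> with \<open>t\<close> acting as conjugation by \<open>x\<close>, written
  multiplicatively.\<close>

definition act :: "int poly \<Rightarrow> 'a \<Rightarrow> 'a" where
  "act h a = fold_coeffs (\<lambda>c b. a [^] c \<otimes> sigma b) h \<one>"

lemma act_0 [simp]: "act 0 a = \<one>"
  by (simp add: act_def)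

lemma act_pCons: "a \<in> A \<Longrightarrow> act (pCons c h) a = a [^] c \<otimes> sigma (act h a)"
  by (cases "c = 0 \<and> h = 0") (auto simp: act_def)

lemma act_closed [simp]: "a \<in> A \<Longrightarrow> act h a \<in> A"
  by (induction h) (auto simp: act_pCons)

lemma act_1 [simp]: "a \<in> A \<Longrightarrow> act 1 a = a"
  by (simp add: one_pCons act_pCons)

lemma act_const: "a \<in> A \<Longrightarrow> act [:c:] a = a [^] c"
  by (simp add: act_pCons)

lemma act_add: "a \<in> A \<Longrightarrow> act (h + k) a = act h a \<otimes> act k a"
  by (induction h k rule: poly_induct2)
    (simp_all add: act_pCons int_pow_mult sigma_mult A_ac)

lemma act_smult: "a \<in> A \<Longrightarrow> act (Polynomial.smult c h) a = act h a [^] c"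
  by (induction h)
    (simp_all add: act_pCons int_pow_pow A_int_pow_distrib sigma_int_pow mult.commute)

lemma act_mult: "a \<in> A \<Longrightarrow> act (h * k) a = act h (act k a)"
  by (induction h) (simp_all add: act_pCons act_add act_smult)

lemma act_diff: "a \<in> A \<Longrightarrow> act (h - k) a = act h a \<otimes> inv (act k a)"
proof -
  assume a: "a \<in> A"
  have "h - k = h + Polynomial.smult (-1) k" by simp
  then show ?thesis using a by (simp only: act_add act_smult) (simp add: int_pow_neg)
qed

lemma act_X_power: "a \<in> A \<Longrightarrow> act ([:0, 1:] ^ j) a = (sigma ^^ j) a"
  by (induction j) (simp_all add: act_mult act_pCons)

text \<open>The operator \<open>1 - t\<close> is the commutator with \<open>x\<close>; this links
  polynomials to the lower central series.\<close>

lemma act_one_minus_X: "a \<in> A \<Longrightarrow> act [:1, -1:] a = a \<otimes> x \<otimes> inv a \<otimes> inv x"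
  by (simp add: act_pCons sigma_int_pow int_pow_neg sigma_inv[symmetric] sigma_def m_assoc)

text \<open>The Laurent polynomial module generated by \<open>a\<close>; negative powers of \<open>t\<close> are cleared by
  applying \<open>sigma\<close> to the other side.\<close>

definition cyc :: "'a \<Rightarrow> 'a set" where
  "cyc a = {y \<in> A. \<exists>j h. (sigma ^^ j) y = act h a}"

lemma cycI: "\<lbrakk>y \<in> A; (sigma ^^ j) y = act h a\<rbrakk> \<Longrightarrow> y \<in> cyc a"
  by (auto simp: cyc_def)

lemma cyc_subset: "y \<in> cyc a \<Longrightarrow> y \<in> A"
  by (simp add: cyc_def)

lemma cyc_self: "a \<in> A \<Longrightarrow> a \<in> cyc a"
  by (rule cycI[of _ 0 1]) auto

lemma cyc_mult:
  assumes a: "a \<in> A" and y: "y \<in> cyc a" and z: "z \<in> cyc a"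
  shows "y \<otimes> z \<in> cyc a"
proof -
  obtain i h where 1: "y \<in> A" "(sigma ^^ i) y = act h a" using y by (auto simp: cyc_def)
  obtain j k where 2: "z \<in> A" "(sigma ^^ j) z = act k a" using z by (auto simp: cyc_def)
  \<comment> \<open>Both elements are brought to the common exponent \<open>i + j\<close>.\<close>
  have "(sigma ^^ (i + j)) y = act ([:0, 1:] ^ j * h) a"
    using a 1 by (simp add: act_mult act_X_power funpow_add add.commute[of i j])
  moreover have "(sigma ^^ (i + j)) z = act ([:0, 1:] ^ i * k) a"
    using a 2 by (simp add: act_mult act_X_power funpow_add)
  ultimately show ?thesis
    using 1 2 a by (intro cycI[of _ "i + j" "[:0, 1:] ^ j * h + [:0, 1:] ^ i * k"])
      (simp_all add: sigma_funpow_mult act_add)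
qed

lemma cyc_int_pow:
  assumes a: "a \<in> A" and y: "y \<in> cyc a"
  shows "y [^] (c::int) \<in> cyc a"
proof -
  obtain i h where 1: "y \<in> A" "(sigma ^^ i) y = act h a" using y by (auto simp: cyc_def)
  then show ?thesis
    using a by (intro cycI[of _ i "Polynomial.smult c h"])
      (simp_all add: sigma_funpow_int_pow act_smult)
qed

lemma cyc_inv: "\<lbrakk>a \<in> A; y \<in> cyc a\<rbrakk> \<Longrightarrow> inv y \<in> cyc a"
  using cyc_int_pow[of a y "-1"] by (simp add: int_pow_neg cyc_subset)

lemma cyc_conj:
  assumes a: "a \<in> A" and y: "y \<in> cyc a"
  shows "x \<otimes> y \<otimes> inv x \<in> cyc a"
proof -
  obtain i h where 1: "y \<in> A" "(sigma ^^ i) y = act h a" using y by (auto simp: cyc_def)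
  have "(sigma ^^ i) (sigma y) = sigma (act h a)" using 1 by (metis funpow_swap1)
  then show ?thesis
    using a 1 by (intro cycI[of _ i "[:0, 1:] * h"]) (simp_all add: act_pCons sigma_def)
qed

lemma cyc_conj_inv:
  assumes a: "a \<in> A" and y: "y \<in> cyc a"
  shows "inv x \<otimes> y \<otimes> x \<in> cyc a"
proof -
  obtain i h where 1: "y \<in> A" "(sigma ^^ i) y = act h a" using y by (auto simp: cyc_def)
  have *: "inv x \<otimes> y \<otimes> x \<in> A" using A_conj[of "inv x" y] 1 by simp
  have "sigma (inv x \<otimes> y \<otimes> x) = y" using 1 by (simp add: sigma_def m_assoc) (simp add: m_assoc[symmetric])
  then have "(sigma ^^ Suc i) (inv x \<otimes> y \<otimes> x) = act h a" using 1 by (simp only: funpow_Suc_right o_apply)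
  then show ?thesis using * by (rule cycI[rotated])
qed

lemma cyc_conj_pow:
  assumes a: "a \<in> A" and y: "y \<in> cyc a"
  shows "x [^] (i::int) \<otimes> y \<otimes> inv (x [^] i) \<in> cyc a"
proof -
  have *: "g [^] n \<otimes> y \<otimes> inv (g [^] n) \<in> cyc a"
    if g: "g \<in> carrier G" "\<And>y. y \<in> cyc a \<Longrightarrow> g \<otimes> y \<otimes> inv g \<in> cyc a" for g and n :: nat
  proof (induction n)
    case 0
    then show ?case using y by (simp add: cyc_subset)
  next
    case (Suc n)
    have "g [^] Suc n = g \<otimes> g [^] n" using g(1) by (rule nat_pow_Suc2)
    then show ?case using g(2)[OF Suc] g(1) cyc_subset[OF y]
      by (simp add: inv_mult_group m_assoc del: nat_pow_Suc)
  qed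
  show ?thesis
  proof (cases i rule: int_cases2)
    case (nonneg n)
    then show ?thesis using *[of x n] cyc_conj[OF a] by (simp add: int_pow_int)
  next
    case (nonpos n)
    then show ?thesis using *[of "inv x" n] cyc_conj_inv[OF a]
      by (simp add: int_pow_neg int_pow_int nat_pow_inv)
  qed
qed

text \<open>As \<open>x\<close> normalises \<open>cyc a\<close>, the subgroup generated by
  \<open>x\<close> and \<open>a\<close> is \<open>cyc a\<close> times the powers of
  \<open>x\<close>. By \<open>free\<close> those powers meet \<open>A\<close> trivially, since a
  power of \<open>x\<close> commutes with \<open>x\<close>.\<close>

lemma cyc_eq:
  assumes a: "a \<in> A" and free: "\<And>y. \<lbrakk>y \<in> A; x \<otimes> y = y \<otimes> x\<rbrakk> \<Longrightarrow> y = \<one>"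
  shows "generate G {x, a} \<inter> A = cyc a"
    and "g \<in> generate G {x, a} \<Longrightarrow> \<exists>i::int. g \<otimes> x [^] i \<in> cyc a"
proof -
  define W where "W = {g \<in> carrier G. \<exists>i::int. g \<otimes> x [^] i \<in> cyc a}"
  have W: "subgroup W G"
  proof (rule subgroupI)
    show "W \<subseteq> carrier G" by (auto simp: W_def)
    have "a \<in> W" using a cyc_self[OF a] by (auto simp: W_def intro!: exI[of _ "0::int"])
    then show "W \<noteq> {}" by auto
  next
    fix g assume "g \<in> W"
    then obtain i :: int where i: "g \<in> carrier G" "g \<otimes> x [^] i \<in> cyc a" by (auto simp: W_def)
    have "x [^] i \<otimes> inv (g \<otimes> x [^] i) \<otimes> inv (x [^] i) \<in> cyc a"
      by (intro cyc_conj_pow a cyc_inv i)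
    also have "x [^] i \<otimes> inv (g \<otimes> x [^] i) \<otimes> inv (x [^] i) = inv g \<otimes> x [^] (- i)"
      using i(1) by (simp add: inv_mult_group m_assoc[symmetric] int_pow_neg)
    finally show "inv g \<in> W" using i(1) by (auto simp: W_def)
  next
    fix g g' assume "g \<in> W" "g' \<in> W"
    then obtain i j :: int where i: "g \<in> carrier G" "g \<otimes> x [^] i \<in> cyc a"
      and j: "g' \<in> carrier G" "g' \<otimes> x [^] j \<in> cyc a" by (auto simp: W_def)
    have "(g \<otimes> x [^] i) \<otimes> (x [^] (-i) \<otimes> (g' \<otimes> x [^] j) \<otimes> inv (x [^] (-i))) \<in> cyc a"
      by (intro cyc_mult cyc_conj_pow a i j)
    also have "(g \<otimes> x [^] i) \<otimes> (x [^] (-i) \<otimes> (g' \<otimes> x [^] j) \<otimes> inv (x [^] (-i)))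
        = g \<otimes> (x [^] i \<otimes> inv (x [^] i)) \<otimes> (g' \<otimes> x [^] j) \<otimes> x [^] i"
      using i(1) j(1) by (simp only: int_pow_neg x_closed inv_inv int_pow_closed inv_closed m_closed m_assoc)
    also have "\<dots> = g \<otimes> g' \<otimes> x [^] (j + i)"
      using i(1) j(1) by (simp add: int_pow_mult m_assoc)
    finally show "g \<otimes> g' \<in> W" using i(1) j(1) by (auto simp: W_def)
  qed
  \<comment> \<open>The exponent is -1, and the identity is seen to lie in \<open>cyc a\<close> as
    \<open>a\<close> times its inverse.\<close>
  have "x \<in> W"
    using cyc_mult[OF a cyc_self[OF a] cyc_inv[OF a cyc_self[OF a]]] a
    by (auto simp: W_def int_pow_neg intro!: exI[of _ "-1::int"])
  moreover have "a \<in> W" using a cyc_self[OF a] by (auto simp: W_def intro!: exI[of _ "0::int"])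
  ultimately have sub: "generate G {x, a} \<subseteq> W" using W by (intro generate_subgroup_incl) auto
  then show "g \<in> generate G {x, a} \<Longrightarrow> \<exists>i::int. g \<otimes> x [^] i \<in> cyc a" by (auto simp: W_def)
  show "generate G {x, a} \<inter> A = cyc a"
  proof
    show "generate G {x, a} \<inter> A \<subseteq> cyc a"
    proof
      fix g assume g: "g \<in> generate G {x, a} \<inter> A"
      then obtain i :: int where i: "g \<otimes> x [^] i \<in> cyc a" using sub by (auto simp: W_def)
      have "inv g \<otimes> (g \<otimes> x [^] i) \<in> A" using g cyc_subset[OF i] by simp
      then have "x [^] i \<in> A" using g by (simp add: m_assoc[symmetric])
      moreover have "x \<otimes> x [^] i = x [^] i \<otimes> x"
        using int_pow_mult[of x 1 i] int_pow_mult[of x i 1] by (simp add: add.commute)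
      ultimately have "x [^] i = \<one>" by (rule free)
      then show "g \<in> cyc a" using i g by simp
    qed
  next
    let ?L = "generate G {x, a}"
    have L: "subgroup ?L G" using a by (intro generate_is_subgroup) auto
    have xL: "x \<in> ?L" and aL: "a \<in> ?L" by (auto intro: generate.incl)
    have actL: "act h a \<in> ?L" for h
    proof (induction h)
      case (pCons c h)
      have "a [^] c \<in> ?L" using L aL by (simp add: subgroup_int_pow_closed)
      moreover have "sigma (act h a) \<in> ?L"
        using pCons xL L unfolding sigma_def
        by (intro subgroup.m_closed[OF L] subgroup.m_inv_closed[OF L])
      ultimately show ?case using a L by (simp add: act_pCons subgroup.m_closed)
    qed (simp add: generate.one)
    \<comment> \<open>Negative powers of \<open>t\<close> are undone by conjugating with
      \<open>inv x\<close>, which stays in the generated subgroup.\<close>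
    have pull: "y \<in> ?L" if "y \<in> A" "(sigma ^^ j) y \<in> ?L" for j y
      using that
    proof (induction j)
      case (Suc j)
      let ?z = "(sigma ^^ j) y"
      have z: "?z \<in> carrier G" using Suc.prems by simp
      have "inv x \<otimes> (sigma ?z) \<otimes> x \<in> ?L"
        using Suc.prems xL by (intro subgroup.m_closed[OF L] subgroup.m_inv_closed[OF L]) auto
      also have "inv x \<otimes> (sigma ?z) \<otimes> x = ?z"
        using z by (simp add: sigma_def m_assoc inv_solve_left')
      finally show ?case using Suc by simp
    qed simp
    show "cyc a \<subseteq> ?L \<inter> A"
    proof
      fix y assume "y \<in> cyc a"
      then obtain j h where "y \<in> A" "(sigma ^^ j) y = act h a" by (auto simp: cyc_def)
      then show "y \<in> ?L \<inter> A" using pull[of y j] actL[of h] by simp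
    qed
  qed
qed

end

section \<open>Just non-nilpotent groups\<close>

context group
begin

lemma lower_central_subset: "lower_central G n \<subseteq> carrier G"
proof (induction n)
  case (Suc n)
  then have "commutator_set G (lower_central G n) (carrier G) \<subseteq> carrier G"
    by (auto simp: commutator_set_def)
  then show ?case by (simp add: generate_incl)
qed simp

lemma one_in_lower_central: "\<one> \<in> lower_central G n"
  by (cases n) (auto intro: generate.one)

lemma commutator_in_lower_central:
  "\<lbrakk>y \<in> lower_central G n; g \<in> carrier G\<rbrakk> \<Longrightarrow> y \<otimes> g \<otimes> inv y \<otimes> inv g \<in> lower_central G (Suc n)"
  by (auto simp: commutator_set_def intro!: generate.incl)

lemma lower_central_Suc_subset:
  assumes "subgroup T G"
    and "\<And>y g. \<lbrakk>y \<in> lower_central G n; g \<in> carrier G\<rbrakk> \<Longrightarrow> y \<otimes> g \<otimes> inv y \<otimes> inv g \<in> T"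
  shows "lower_central G (Suc n) \<subseteq> T"
  unfolding lower_central.simps
  by (rule generate_subgroup_incl) (use assms in \<open>auto simp: commutator_set_def\<close>)

lemma commutator_eq_one_iff:
  "\<lbrakk>a \<in> carrier G; b \<in> carrier G\<rbrakk> \<Longrightarrow> a \<otimes> b \<otimes> inv a \<otimes> inv b = \<one> \<longleftrightarrow> a \<otimes> b = b \<otimes> a"
  by (simp add: inv_solve_right')

lemma commutator_in_normal:
  assumes "T \<lhd> G" "a \<in> T" "g \<in> carrier G"
  shows "a \<otimes> g \<otimes> inv a \<otimes> inv g \<in> T"
proof -
  have T: "subgroup T G" using assms(1) by (rule normal_imp_subgroup)
  have a: "a \<in> carrier G" using T assms(2) by (rule subgroup.mem_carrier)
  have "a \<otimes> (g \<otimes> inv a \<otimes> inv g) \<in> T"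
    using assms T by (simp add: subgroup.m_closed subgroup.m_inv_closed normal.inv_op_closed2)
  then show ?thesis using a assms(3) by (simp add: m_assoc)
qed

lemma conj_int_pow:
  assumes "g \<in> carrier G" "a \<in> carrier G"
  shows "g \<otimes> a [^] (c::int) \<otimes> inv g = (g \<otimes> a \<otimes> inv g) [^] c"
  using hom_int_pow[OF conj_hom[OF assms(1)] assms(2)] by (simp add: is_group)

definition centralizer :: "'a set \<Rightarrow> 'a set" where
  "centralizer L = {g \<in> carrier G. \<forall>l\<in>L. g \<otimes> l = l \<otimes> g}"

lemma centralizer_subgroup:
  assumes "L \<subseteq> carrier G"
  shows "subgroup (centralizer L) G"
proof (rule subgroupI)
  fix a assume a: "a \<in> centralizer L"
  show "inv a \<in> centralizer L"
    unfolding centralizer_def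
  proof (intro CollectI conjI ballI)
    show "inv a \<in> carrier G" using a by (auto simp: centralizer_def)
    fix l assume l: "l \<in> L"
    have al: "a \<otimes> l = l \<otimes> a" and c: "a \<in> carrier G" "l \<in> carrier G"
      using a l assms by (auto simp: centralizer_def)
    have "a \<otimes> (l \<otimes> inv a) = (a \<otimes> l) \<otimes> inv a" using c by (simp add: m_assoc)
    also have "\<dots> = l" unfolding al using c by (simp add: m_assoc)
    finally show "inv a \<otimes> l = l \<otimes> inv a" using c by (simp add: inv_solve_left')
  qed
next
  fix a b assume a: "a \<in> centralizer L" and b: "b \<in> centralizer L"
  show "a \<otimes> b \<in> centralizer L"
    unfolding centralizer_def
  proof (intro CollectI conjI ballI)
    show "a \<otimes> b \<in> carrier G" using a b by (auto simp: centralizer_def)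
    fix l assume l: "l \<in> L"
    have al: "a \<otimes> l = l \<otimes> a" and bl: "b \<otimes> l = l \<otimes> b"
      and c: "a \<in> carrier G" "b \<in> carrier G" "l \<in> carrier G"
      using a b l assms by (auto simp: centralizer_def)
    have "a \<otimes> b \<otimes> l = a \<otimes> (l \<otimes> b)" using c bl by (simp add: m_assoc)
    also have "\<dots> = a \<otimes> l \<otimes> b" using c by (simp add: m_assoc)
    also have "\<dots> = l \<otimes> (a \<otimes> b)" unfolding al using c by (simp add: m_assoc)
    finally show "a \<otimes> b \<otimes> l = l \<otimes> (a \<otimes> b)" .
  qed
next
  have "\<one> \<in> centralizer L" using assms by (auto simp: centralizer_def)
  then show "centralizer L \<noteq> {}" by blast
qed (auto simp: centralizer_def)

text \<open>Commuting is symmetric, so \<open>g\<close> centralises \<open>S\<close> exactly when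
  \<open>S\<close> lies in the subgroup \<open>centralizer {g}\<close>.\<close>

lemma centralizer_generate:
  assumes "S \<subseteq> carrier G"
  shows "centralizer (generate G S) = centralizer S"
proof
  show "centralizer (generate G S) \<subseteq> centralizer S"
    by (auto simp: centralizer_def intro: generate.incl)
  show "centralizer S \<subseteq> centralizer (generate G S)"
  proof
    fix g assume g: "g \<in> centralizer S"
    then have gc: "g \<in> carrier G" by (simp add: centralizer_def)
    have "S \<subseteq> centralizer {g}" using g assms by (auto simp: centralizer_def)
    then have "generate G S \<subseteq> centralizer {g}"
      using gc by (intro generate_subgroup_incl centralizer_subgroup) auto
    then show "g \<in> centralizer (generate G S)" using gc by (auto simp: centralizer_def)
  qed
qed

lemma centralizer_normal:
  assumes L: "L \<lhd> G"
  shows "centralizer L \<lhd> G"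
proof -
  have Ls: "L \<subseteq> carrier G" by (rule subgroup.subset[OF normal_imp_subgroup[OF L(1)]])
  have "g \<otimes> c \<otimes> inv g \<in> centralizer L" if g: "g \<in> carrier G" and c: "c \<in> centralizer L" for g c
    unfolding centralizer_def
  proof (intro CollectI conjI ballI)
    have cc: "c \<in> carrier G" using c by (simp add: centralizer_def)
    then show "g \<otimes> c \<otimes> inv g \<in> carrier G" using g by simp
    fix l assume l: "l \<in> L"
    then have lc: "l \<in> carrier G" using Ls by blast
    have "inv g \<otimes> l \<otimes> g \<in> L" using L g l by (simp add: normal.inv_op_closed1)
    then have comm: "c \<otimes> (inv g \<otimes> l \<otimes> g) = (inv g \<otimes> l \<otimes> g) \<otimes> c"
      using c by (simp add: centralizer_def)
    have "g \<otimes> c \<otimes> inv g \<otimes> l = g \<otimes> (c \<otimes> (inv g \<otimes> l \<otimes> g)) \<otimes> inv g"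
      using g cc lc by (simp add: m_assoc)
    also have "\<dots> = g \<otimes> ((inv g \<otimes> l \<otimes> g) \<otimes> c) \<otimes> inv g" by (simp only: comm)
    also have "\<dots> = (g \<otimes> inv g) \<otimes> l \<otimes> (g \<otimes> c \<otimes> inv g)"
      using g cc lc by (simp only: m_assoc m_closed inv_closed)
    finally show "g \<otimes> c \<otimes> inv g \<otimes> l = l \<otimes> (g \<otimes> c \<otimes> inv g)" using g cc lc by simp
  qed
  then show ?thesis using centralizer_subgroup[OF Ls] by (simp add: normal_inv_iff)
qed

text \<open>Conjugation maps the group to the finite set of functions from \<open>L\<close> to
  \<open>L\<close>, and two elements acting alike differ by an element of
  \<open>centralizer L\<close>.\<close>

lemma finite_if_centralizer_trivial:
  assumes L: "L \<lhd> G" "finite L" and C: "centralizer L = {\<one>}"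
  shows "finite (carrier G)"
proof -
  let ?f = "\<lambda>g. \<lambda>l\<in>L. g \<otimes> l \<otimes> inv g"
  have Ls: "L \<subseteq> carrier G" by (rule subgroup.subset[OF normal_imp_subgroup[OF L(1)]])
  have "?f ` carrier G \<subseteq> L \<rightarrow>\<^sub>E L"
  proof
    fix f assume "f \<in> ?f ` carrier G"
    then obtain g where "g \<in> carrier G" "f = ?f g" by blast
    then show "f \<in> L \<rightarrow>\<^sub>E L" using normal.inv_op_closed2[OF L(1)] by simp
  qed
  then have "finite (?f ` carrier G)" using L(2) by (meson finite_PiE finite_subset)
  moreover have "inj_on ?f (carrier G)"
  proof (rule inj_onI)
    fix g h assume g: "g \<in> carrier G" and h: "h \<in> carrier G" and eq: "?f g = ?f h"
    have "inv h \<otimes> g \<in> centralizer L"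
      unfolding centralizer_def
    proof (intro CollectI conjI ballI)
      show "inv h \<otimes> g \<in> carrier G" using g h by simp
      fix l assume l: "l \<in> L"
      have lc: "l \<in> carrier G" using Ls l by blast
      have "g \<otimes> l \<otimes> inv g = h \<otimes> l \<otimes> inv h" using fun_cong[OF eq, of l] l by simp
      then have "inv h \<otimes> (g \<otimes> l \<otimes> inv g) \<otimes> g = inv h \<otimes> (h \<otimes> l \<otimes> inv h) \<otimes> g" by simp
      then have "inv h \<otimes> g \<otimes> l \<otimes> (inv g \<otimes> g) = (inv h \<otimes> h) \<otimes> l \<otimes> (inv h \<otimes> g)"
        using g h lc by (simp only: m_assoc m_closed inv_closed)
      then show "inv h \<otimes> g \<otimes> l = l \<otimes> (inv h \<otimes> g)" using g h lc by simp
    qed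
    then have "inv h \<otimes> g = \<one>" using C by simp
    then show "g = h" using g h by (simp add: inv_solve_left')
  qed
  ultimately show ?thesis by (rule finite_imageD)
qed

end

text \<open>The second assumption says that every proper quotient is nilpotent: a term of the lower
  central series lies in \<open>T\<close> exactly when its image modulo \<open>T\<close> is
  trivial.\<close>

locale just_non_nilpotent = group G for G (structure) +
  assumes lower_central_nontrivial: "lower_central G n \<noteq> {\<one>}"
    and lower_central_le_normal: "\<lbrakk>T \<lhd> G; T \<noteq> {\<one>}\<rbrakk> \<Longrightarrow> \<exists>n. lower_central G n \<subseteq> T"
begin

text \<open>A nontrivial centre would contain a term of the lower central series, and the next term
  would be trivial.\<close>

lemma center_trivial:
  assumes z: "z \<in> carrier G" "\<And>g. g \<in> carrier G \<Longrightarrow> z \<otimes> g = g \<otimes> z"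
  shows "z = \<one>"
proof (rule ccontr)
  assume "z \<noteq> \<one>"
  let ?Z = "centralizer (carrier G)"
  have "z \<in> ?Z" using z by (simp add: centralizer_def)
  then have "?Z \<noteq> {\<one>}" using \<open>z \<noteq> \<one>\<close> by auto
  moreover have "?Z \<lhd> G" by (intro centralizer_normal normal_self)
  ultimately obtain n where n: "lower_central G n \<subseteq> ?Z" using lower_central_le_normal by blast
  have "lower_central G (Suc n) \<subseteq> {\<one>}"
  proof (rule lower_central_Suc_subset)
    show "subgroup {\<one>} G" using one_is_normal by (rule normal_imp_subgroup)
    fix y g assume y: "y \<in> lower_central G n" and g: "g \<in> carrier G"
    then have "y \<in> carrier G" "y \<otimes> g = g \<otimes> y"
      using n unfolding centralizer_def by blast+
    then show "y \<otimes> g \<otimes> inv y \<otimes> inv g \<in> {\<one>}"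
      using g commutator_eq_one_iff[of y g] by blast
  qed
  then show False using lower_central_nontrivial[of "Suc n"] one_in_lower_central[of "Suc n"] by blast
qed

lemma exists_nontrivial_commutator:
  assumes "z \<in> carrier G" "z \<noteq> \<one>"
  shows "\<exists>g\<in>carrier G. z \<otimes> g \<otimes> inv z \<otimes> inv g \<noteq> \<one>"
proof (rule ccontr)
  assume "\<not> ?thesis"
  then have "z \<otimes> g = g \<otimes> z" if "g \<in> carrier G" for g
    using that commutator_eq_one_iff[OF assms(1) that] by blast
  then show False using center_trivial[OF assms(1)] assms(2) by blast
qed

text \<open>Since the centre is trivial, a nontrivial element of \<open>B\<close> has a nontrivial
  commutator with some \<open>g\<close>; this commutator stays in \<open>B\<close> and lies one term
  deeper.\<close>

lemma normal_meets_lower_central: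
  assumes B: "B \<lhd> G" "B \<noteq> {\<one>}"
  shows "\<exists>b\<in>B. b \<in> lower_central G n \<and> b \<noteq> \<one>"
proof (induction n)
  case 0
  have "subgroup B G" using B(1) by (rule normal_imp_subgroup)
  then have "\<one> \<in> B" "B \<subseteq> carrier G" by (auto simp: subgroup.one_closed subgroup.mem_carrier)
  then show ?case using B(2) by auto
next
  case (Suc n)
  then obtain b where b: "b \<in> B" "b \<in> lower_central G n" "b \<noteq> \<one>" by blast
  then have "b \<in> carrier G" using lower_central_subset by blast
  then obtain g where g: "g \<in> carrier G" "b \<otimes> g \<otimes> inv b \<otimes> inv g \<noteq> \<one>"
    using exists_nontrivial_commutator[of b] b(3) by blast
  then show ?case
    using commutator_in_lower_central[OF b(2) g(1)] commutator_in_normal[OF B(1) b(1) g(1)] by blast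
qed

text \<open>A nontrivial \<open>T\<close> contains a term of the lower central series, and
  \<open>B\<close> meets every term nontrivially.\<close>

lemma normal_disjoint_trivial:
  assumes "B \<lhd> G" "B \<noteq> {\<one>}" "T \<lhd> G" "B \<inter> T \<subseteq> {\<one>}"
  shows "T = {\<one>}"
proof (rule ccontr)
  assume "T \<noteq> {\<one>}"
  then obtain n where "lower_central G n \<subseteq> T" using lower_central_le_normal assms(3) by blast
  then show False using normal_meets_lower_central[OF assms(1,2), of n] assms(4) by blast
qed

end

text \<open>Under the first assumption the subgroups in the second are not nilpotent, so the second
  is what the meta-nilpotent-Hamiltonian property provides.\<close>

locale jnn_module = just_non_nilpotent G + conj_module G A x for G (structure) and A x +
  assumes fixpoint_free: "\<lbrakk>y \<in> A; x \<otimes> y = y \<otimes> x\<rbrakk> \<Longrightarrow> y = \<one>"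
    and generate_normal: "\<lbrakk>a \<in> A; a \<noteq> \<one>\<rbrakk> \<Longrightarrow> generate G {x, a} \<lhd> G"
begin

lemma cyc_normal:
  assumes "a \<in> A" "a \<noteq> \<one>"
  shows "cyc a \<lhd> G"
proof -
  have "generate G {x, a} \<inter> A = cyc a"
    by (rule cyc_eq(1)[OF assms(1)]) (rule fixpoint_free)
  then show ?thesis
    using normal_subgroup_intersect[OF generate_normal[OF assms] A_normal] by argo
qed

lemma cyc_nontrivial: "\<lbrakk>a \<in> A; a \<noteq> \<one>\<rbrakk> \<Longrightarrow> cyc a \<noteq> {\<one>}"
  using cyc_self[of a] by auto

lemma act_in_lower_central: "a \<in> A \<Longrightarrow> act ([:1, -1:] ^ n) a \<in> lower_central G n"
proof (induction n)
  case (Suc n)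
  have "act ([:1, -1:] ^ Suc n) a = act [:1, -1:] (act ([:1, -1:] ^ n) a)"
    using Suc.prems by (simp only: power_Suc act_mult)
  also have "\<dots> \<in> lower_central G (Suc n)"
    using commutator_in_lower_central[OF Suc.IH[OF Suc.prems] x_closed] Suc.prems
    by (simp only: act_one_minus_X act_closed)
  finally show ?case .
qed simp

text \<open>Just non-nilpotency in module form: \<open>1 - t\<close> acts nilpotently on each
  element of \<open>A\<close> modulo any nontrivial normal subgroup.\<close>

lemma act_in_normal:
  assumes "a \<in> A" "T \<lhd> G" "T \<noteq> {\<one>}"
  shows "\<exists>n. act ([:1, -1:] ^ n) a \<in> T"
proof -
  obtain n where "lower_central G n \<subseteq> T" using lower_central_le_normal[OF assms(2,3)] ..
  then show ?thesis using act_in_lower_central[OF assms(1), of n] by auto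
qed

text \<open>If \<open>t\<^sup>2 - t + 1\<close> does not kill \<open>a\<close>, some \<open>t\<^sup>j (1 - t)\<^sup>n a\<close> is a multiple of \<open>(t\<^sup>2 - t + 1) a\<close>; the
  resulting relation is nonzero modulo every prime because \<open>t\<^sup>2 - t + 1 = 1 - t (1 - t)\<close> is coprime to
  \<open>t (1 - t)\<close>.\<close>

lemma exists_relation:
  fixes p :: int
  assumes a: "a \<in> A" and p: "Factorial_Ring.prime p"
  shows "\<exists>h. act h a = \<one> \<and> \<not> [:p:] dvd h"
proof -
  define f :: "int poly" where "f = [:1, -1, 1:]"
  have np: "\<not> p dvd 1" using p not_prime_unit by blast
  show ?thesis
  proof (cases "act f a = \<one>")
    case True
    have "\<not> [:p:] dvd f"
    proof
      assume "[:p:] dvd f"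
      then have "p dvd poly.coeff f 0" by (simp only: const_poly_dvd_iff)
      then show False using np by (simp add: f_def)
    qed
    then show ?thesis using True by blast
  next
    case False
    let ?b = "act f a"
    have b: "?b \<in> A" using a by simp
    obtain n where "act ([:1, -1:] ^ n) a \<in> cyc ?b"
      using act_in_normal[OF a cyc_normal[OF b False] cyc_nontrivial[OF b False]] by blast
    then obtain j g where g: "(sigma ^^ j) (act ([:1, -1:] ^ n) a) = act g ?b"
      by (auto simp: cyc_def)
    define h where "h = f * g - Polynomial.smult 1 ([:0, 1:] ^ j * [:1, -1:] ^ n)"
    have "act ([:0, 1:] ^ j * [:1, -1:] ^ n) a = act (g * f) a"
      using a g by (simp add: act_mult act_X_power)
    then have "act h a = \<one>"
      using a by (simp add: h_def act_diff mult.commute[of f g])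
    \<comment> \<open>The leading coefficient of \<open>f\<close> and its values at 0 and 1 are all
      equal to 1.\<close>
    moreover have "\<not> [:p:] dvd h"
      unfolding h_def
      by (rule not_dvd_mult_minus_powers[OF p]) (use np in \<open>simp_all add: f_def\<close>)
    ultimately show ?thesis by blast
  qed
qed

end

text \<open>Leading terms divisible by \<open>p\<close> are dropped one after another; this cannot
  exhaust \<open>h\<close>, which is nonzero modulo \<open>p\<close>.\<close>

lemma exists_cong_lead_coeff_not_dvd:
  fixes p :: int and h :: "int poly"
  assumes "\<not> [:p:] dvd h"
  shows "\<exists>h'. [:p:] dvd h - h' \<and> \<not> p dvd lead_coeff h'"
  using assms
proof (induction "Polynomial.degree h" arbitrary: h rule: less_induct)
  case less
  show ?case
  proof (cases "p dvd lead_coeff h")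
    case False
    then show ?thesis by (intro exI[of _ h]) simp
  next
    case True
    let ?e = "Polynomial.degree h"
    define m where "m = Polynomial.monom (lead_coeff h) ?e"
    have m: "[:p:] dvd m" using True by (auto simp: m_def const_poly_dvd_iff)
    have "?e \<noteq> 0"
    proof
      assume e: "?e = 0"
      then obtain c where "h = [:c:]" by (metis degree_eq_zeroE)
      then show False using True less.prems by simp
    qed
    have lt: "Polynomial.degree (h - m) < ?e"
    proof (rule coeff_0_degree_minus_1[THEN le_less_trans])
      show "poly.coeff (h - m) ?e = 0" by (simp add: m_def)
      show "Polynomial.degree (h - m) \<le> ?e" unfolding m_def
        by (intro degree_diff_le) (simp_all add: degree_monom_le)
      show "?e - 1 < ?e" using \<open>?e \<noteq> 0\<close> by simp
    qed
    have "\<not> [:p:] dvd h - m" using less.prems m by (simp add: dvd_diff_left_iff)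
    then obtain h' where h': "[:p:] dvd (h - m) - h'" "\<not> p dvd lead_coeff h'"
      using less.hyps[OF lt] by blast
    have "[:p:] dvd (h - m - h') + m" using h'(1) m by (rule dvd_add)
    then show ?thesis using h'(2) by (intro exI[of _ h']) simp
  qed
qed

section \<open>Finiteness of cyclic modules of prime exponent\<close>

context conj_module
begin

lemma act_on_one [simp]: "act h \<one> = \<one>"
  by (induction h) (simp_all add: act_pCons)

lemma act_multiple_eq_one:
  assumes "a \<in> A" "a [^] (p::int) = \<one>" "[:p:] dvd h"
  shows "act h a = \<one>"
proof -
  obtain k where "h = [:p:] * k" using assms(3) by (rule dvdE)
  then have "act h a = act k (act [:p:] a)" using assms(1) by (simp only: mult.commute[of "[:p:]"] act_mult)
  then show ?thesis using assms(1,2) by (simp add: act_const)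
qed

text \<open>Coefficients matter only modulo \<open>p\<close>, so each Horner step offers finitely
  many choices.\<close>

lemma finite_act_degree_le:
  fixes p :: int
  assumes a: "a \<in> A" "a [^] p = \<one>" and p: "p > 0"
  shows "finite {act r a |r. Polynomial.degree r \<le> d}"
proof -
  have pows: "a [^] c \<in> (\<lambda>i. a [^] i) ` {0..<p}" for c :: int
  proof -
    have "a [^] c = a [^] (p * (c div p) + c mod p)" by simp
    also have "\<dots> = (a [^] p) [^] (c div p) \<otimes> a [^] (c mod p)"
      using a(1) by (simp only: int_pow_mult int_pow_pow A_carrier)
    also have "\<dots> = a [^] (c mod p)" using a by simp
    finally show ?thesis using p by (intro image_eqI[of _ _ "c mod p"]) simp_all
  qed
  let ?P = "(\<lambda>i. a [^] i) ` {0..<p}"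
  have fP: "finite ?P" by simp
  show ?thesis
  proof (induction d)
    case 0
    have "{act r a |r. Polynomial.degree r \<le> 0} \<subseteq> ?P"
    proof
      fix y assume "y \<in> {act r a |r. Polynomial.degree r \<le> 0}"
      then obtain r where r: "y = act r a" "Polynomial.degree r = 0" by auto
      then obtain c where "r = [:c:]" by (metis degree_eq_zeroE)
      then show "y \<in> ?P" using r(1) a(1) pows[of c] by (simp add: act_const)
    qed
    then show ?case using fP by (rule finite_subset)
  next
    case (Suc d)
    let ?R = "{act r a |r. Polynomial.degree r \<le> d}"
    have "{act r a |r. Polynomial.degree r \<le> Suc d} \<subseteq> (\<lambda>(y, z). y \<otimes> sigma z) ` (?P \<times> ?R)"
    proof
      fix y assume "y \<in> {act r a |r. Polynomial.degree r \<le> Suc d}"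
      then obtain r where r: "y = act r a" "Polynomial.degree r \<le> Suc d" by auto
      obtain c r' where cr: "r = pCons c r'" by (cases r)
      have "Polynomial.degree r' \<le> d" using r(2) cr by (cases "r' = 0") auto
      then have "act r' a \<in> ?R" by blast
      moreover have "y = a [^] c \<otimes> sigma (act r' a)" using r(1) cr a(1) by (simp add: act_pCons)
      ultimately show "y \<in> (\<lambda>(y, z). y \<otimes> sigma z) ` (?P \<times> ?R)"
        using pows[of c] by (intro image_eqI[of _ _ "(a [^] c, act r' a)"]) simp_all
    qed
    moreover have "finite ((\<lambda>(y, z). y \<otimes> sigma z) ` (?P \<times> ?R))" using Suc fP by blast
    ultimately show ?case by (rule finite_subset)
  qed
qed

text \<open>Modulo \<open>p\<close> the relation can be given a leading coefficient prime to
  \<open>p\<close>. Division by it bounds the degree of the polynomials applied to \<open>a\<close>,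
  and negative powers of \<open>t\<close> then yield nothing new.\<close>

lemma finite_cyc:
  fixes p :: int
  assumes a: "a \<in> A" "a [^] p = \<one>" and p: "Factorial_Ring.prime p"
    and h: "act h a = \<one>" "\<not> [:p:] dvd h"
  shows "finite (cyc a)"
proof -
  obtain h' where h': "[:p:] dvd h - h'" "\<not> p dvd lead_coeff h'"
    using exists_cong_lead_coeff_not_dvd[OF h(2)] by blast
  have "act h' a = act (h - (h - h')) a" by simp
  also have "\<dots> = \<one>" using a(1) h(1) act_multiple_eq_one[OF a h'(1)] by (simp only: act_diff) simp
  finally have h'1: "act h' a = \<one>" .
  let ?d = "Polynomial.degree h'" and ?c = "lead_coeff h'"
  have h'0: "h' \<noteq> 0" using h'(2) by auto
  have "act k a \<in> {act r a |r. Polynomial.degree r \<le> ?d}" for k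
  proof -
    \<comment> \<open>Over the integers, division by \<open>h'\<close> costs the factor
      \<open>C\<close>, a power of its leading coefficient. As \<open>C\<close> is prime to
      \<open>p\<close>, it is invertible on elements killed by \<open>p\<close>.\<close>
    obtain q r where qr: "pseudo_divmod k h' = (q, r)" by (cases "pseudo_divmod k h'")
    define C where "C = ?c ^ (Suc (Polynomial.degree k) - ?d)"
    have k: "Polynomial.smult C k = q * h' + r"
      using pseudo_divmod(1)[OF h'0 qr] by (simp add: C_def mult.commute)
    have r: "Polynomial.degree r \<le> ?d" using pseudo_divmod(2)[OF h'0 qr] by auto
    have "act r a = act (q * h' + r) a" using a(1) h'1 by (simp add: act_add act_mult)
    also have "\<dots> = act k a [^] C" using a(1) by (simp only: k[symmetric] act_smult)
    finally have rk: "act r a = act k a [^] C" .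
    have "coprime p C" using p h'(2) by (auto simp: C_def prime_imp_coprime)
    then obtain v w where vw: "v * p + w * C = 1" using bezout_int[of p C] by (auto simp: coprime_iff_gcd_eq_1)
    have kp: "act k a [^] p = \<one>"
      using act_multiple_eq_one[OF a, of "[:p:] * k", OF dvd_triv_left] a(1) by (simp add: act_smult)
    have "act k a = act k a [^] (p * v + C * w)" using vw a(1) by (simp add: mult.commute)
    also have "\<dots> = (act k a [^] p) [^] v \<otimes> (act k a [^] C) [^] w"
      using a(1) by (simp only: int_pow_mult int_pow_pow A_carrier act_closed)
    also have "\<dots> = act (Polynomial.smult w r) a"
      using a(1) by (simp add: kp rk[symmetric] act_smult)
    finally have "act k a = act (Polynomial.smult w r) a" .
    moreover have "Polynomial.degree (Polynomial.smult w r) \<le> ?d"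
      using r degree_smult_le order_trans by blast
    ultimately show ?thesis by blast
  qed
  then have "range (\<lambda>k. act k a) \<subseteq> {act r a |r. Polynomial.degree r \<le> ?d}" by blast
  moreover have "p > 0" using p by (simp add: prime_gt_0_int)
  ultimately have fin: "finite (range (\<lambda>k. act k a))"
    using finite_act_degree_le[OF a, of ?d] finite_subset by blast
  let ?R = "range (\<lambda>k. act k a)"
  have RA: "?R \<subseteq> A" using a(1) by auto
  have "sigma ` ?R \<subseteq> ?R"
  proof
    fix y assume "y \<in> sigma ` ?R"
    then obtain k where "y = sigma (act k a)" by blast
    then have "y = act (pCons 0 k) a" using a(1) by (simp add: act_pCons)
    then show "y \<in> ?R" by blast
  qed
  moreover have inj: "inj_on sigma ?R" using RA sigma_inj by (meson inj_onI subsetD)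
  \<comment> \<open>An injective self-map of a finite set is onto, so undoing \<open>sigma\<close>
    does not lead out of \<open>?R\<close>.\<close>
  ultimately have sR: "sigma ` ?R = ?R" using fin by (simp add: endo_inj_surj)
  have pull: "y \<in> ?R" if "y \<in> A" "(sigma ^^ j) y \<in> ?R" for y j
    using that(2)
  proof (induction j)
    case (Suc j)
    have "sigma ((sigma ^^ j) y) \<in> sigma ` ?R" using Suc.prems sR by simp
    then obtain z where "z \<in> ?R" "sigma ((sigma ^^ j) y) = sigma z" by blast
    moreover from this have "z \<in> A" using RA by blast
    ultimately have "(sigma ^^ j) y \<in> ?R"
      using sigma_inj[of "(sigma ^^ j) y" z] that(1) by simp
    then show ?case by (rule Suc.IH)
  qed simp
  have "cyc a \<subseteq> ?R"
  proof
    fix y assume "y \<in> cyc a"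
    then obtain j k where "y \<in> A" "(sigma ^^ j) y = act k a" by (auto simp: cyc_def)
    then show "y \<in> ?R" using pull[of y j] by simp
  qed
  then show ?thesis using fin by (rule finite_subset)
qed

end

section \<open>Finiteness of the group, by way of torsion in the module\<close>

context jnn_module
begin

lemma finite_if_torsion:
  fixes p :: int
  assumes a: "a \<in> A" "a \<noteq> \<one>" "a [^] p = \<one>" and p: "Factorial_Ring.prime p"
  shows "finite (carrier G)"
proof -
  obtain h where h: "act h a = \<one>" "\<not> [:p:] dvd h" using exists_relation[OF a(1) p] by blast
  have M: "finite (cyc a)" by (rule finite_cyc[OF a(1,3) p h])
  let ?L = "generate G {x, a}"
  have L: "?L \<lhd> G" by (rule generate_normal[OF a(1,2)])
  have xa: "{x, a} \<subseteq> carrier G" using a(1) by simp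
  have xL: "x \<in> ?L" by (auto intro: generate.incl)
  \<comment> \<open>An element of \<open>cyc a\<close> that commutes with \<open>x\<close> is
    trivial, so \<open>cyc a\<close> and \<open>centralizer ?L\<close> are normal subgroups with
    trivial intersection.\<close>
  have C: "centralizer ?L = {\<one>}"
  proof (rule normal_disjoint_trivial[OF cyc_normal[OF a(1,2)] cyc_nontrivial[OF a(1,2)]])
    show "centralizer ?L \<lhd> G" using L by (rule centralizer_normal)
    show "cyc a \<inter> centralizer ?L \<subseteq> {\<one>}"
    proof
      fix y assume y: "y \<in> cyc a \<inter> centralizer ?L"
      then have "x \<otimes> y = y \<otimes> x" using xL by (simp add: centralizer_def)
      moreover have "y \<in> A" using y cyc_subset[of y a] by simp
      ultimately show "y \<in> {\<one>}" using fixpoint_free by simp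
    qed
  qed
  \<comment> \<open>The orbit of \<open>a\<close> under \<open>sigma\<close> lies in the finite set
    \<open>cyc a\<close>, so it repeats; injectivity of \<open>sigma\<close> moves the repetition
    back to \<open>a\<close> itself.\<close>
  have "\<exists>k::nat. k > 0 \<and> (sigma ^^ k) a = a"
  proof -
    have "(sigma ^^ j) a \<in> cyc a" for j
      by (rule cycI[of _ 0 "[:0, 1:] ^ j"]) (use a(1) in \<open>simp_all add: act_X_power\<close>)
    then have "finite (range (\<lambda>j. (sigma ^^ j) a))" using M by (meson finite_subset image_subsetI)
    then have "\<not> inj (\<lambda>j. (sigma ^^ j) a)" using finite_imageD infinite_UNIV_nat by blast
    then obtain i j where "i < j" "(sigma ^^ i) a = (sigma ^^ j) a"
      by (metis linorder_injI)
    then have "(sigma ^^ i) ((sigma ^^ (j - i)) a) = (sigma ^^ i) a"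
      by (metis add_diff_inverse_nat funpow_add not_less_iff_gr_or_eq o_apply)
    then have "(sigma ^^ (j - i)) a = a" using a(1) sigma_funpow_inj[of "(sigma ^^ (j - i)) a" a i] by simp
    then show ?thesis using \<open>i < j\<close> by (intro exI[of _ "j - i"]) simp
  qed
  then obtain k :: nat where k: "k > 0" "(sigma ^^ k) a = a" by blast
  have "x [^] k \<otimes> a = a \<otimes> x [^] k"
    using k(2) a(1) by (simp add: sigma_funpow_eq inv_solve_right')
  moreover have "x [^] k \<otimes> x = x \<otimes> x [^] k"
    using nat_pow_Suc2[of x k] by simp
  ultimately have "x [^] k \<in> centralizer {x, a}" by (simp add: centralizer_def)
  then have xk: "x [^] k = \<one>" using C centralizer_generate[OF xa] by simp
  \<comment> \<open>Each element is a member of \<open>cyc a\<close> times a power of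
    \<open>x\<close>, whose exponent counts only modulo \<open>k\<close>.\<close>
  have "?L \<subseteq> (\<lambda>(m, i). m \<otimes> x [^] i) ` (cyc a \<times> {0..<int k})"
  proof
    fix g assume g: "g \<in> ?L"
    then have gc: "g \<in> carrier G" using xa generate_in_carrier by blast
    obtain i :: int where i: "g \<otimes> x [^] i \<in> cyc a" using cyc_eq(2)[OF a(1) _ g] fixpoint_free by blast
    have "x [^] (- i) = x [^] (int k * (- i div int k) + - i mod int k)" by simp
    also have "\<dots> = (x [^] int k) [^] (- i div int k) \<otimes> x [^] (- i mod int k)"
      by (simp only: int_pow_mult int_pow_pow x_closed)
    also have "\<dots> = x [^] (- i mod int k)" using xk by (simp add: int_pow_int)
    finally have *: "x [^] (- i) = x [^] (- i mod int k)" .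
    have "g = g \<otimes> x [^] i \<otimes> x [^] (- i)" using gc by (simp add: int_pow_neg m_assoc)
    then have "g = g \<otimes> x [^] i \<otimes> x [^] (- i mod int k)" by (simp only: *)
    then show "g \<in> (\<lambda>(m, i). m \<otimes> x [^] i) ` (cyc a \<times> {0..<int k})"
      using i k(1) by (intro image_eqI[of _ _ "(g \<otimes> x [^] i, - i mod int k)"]) simp_all
  qed
  moreover have "finite ((\<lambda>(m, i). m \<otimes> x [^] i) ` (cyc a \<times> {0..<int k}))" using M by simp
  ultimately have "finite ?L" by (rule finite_subset)
  then show ?thesis using finite_if_centralizer_trivial[OF L _ C] by blast
qed

lemma torsion_if_nontrivial:
  assumes a: "a \<in> A" "a \<noteq> \<one>"
  shows "\<exists>b\<in>A. \<exists>c::int. b \<noteq> \<one> \<and> c \<noteq> 0 \<and> b [^] c = \<one>"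
proof (rule ccontr)
  assume "\<not> ?thesis"
  then have tf: "c = 0" if "b \<in> A" "b \<noteq> \<one>" "b [^] c = \<one>" for b and c :: int
    using that by blast
  let ?P = "\<lambda>h. h \<noteq> 0 \<and> act h a = \<one>"
  \<comment> \<open>The choice of the prime 2 is arbitrary; it serves to make \<open>h0\<close>
    nonzero.\<close>
  obtain h0 where "act h0 a = \<one>" "\<not> [:2:] dvd h0" using exists_relation[OF a(1), of 2] by auto
  then have "?P h0" by auto
  then obtain h where h: "h \<noteq> 0" "act h a = \<one>"
    and min: "\<And>k. ?P k \<Longrightarrow> Polynomial.degree h \<le> Polynomial.degree k"
    using ex_has_least_nat[of ?P h0 Polynomial.degree] by blast
  have deg: "Polynomial.degree h \<ge> 1"
  proof (rule ccontr)
    assume "\<not> ?thesis"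
    then have "Polynomial.degree h = 0" by simp
    then obtain c where c: "h = [:c:]" by (metis degree_eq_zeroE)
    then show False using h tf[OF a] a(1) by (simp add: act_const)
  qed
  \<comment> \<open>Otherwise \<open>t\<close> splits off, and injectivity of \<open>sigma\<close>
    makes the cofactor a relation of smaller degree.\<close>
  have h0: "poly h 0 \<noteq> 0"
  proof
    assume z: "poly h 0 = 0"
    obtain c h' where ch: "h = pCons c h'" by (cases h)
    then have hc: "h = pCons 0 h'" using z by simp
    then have h': "h' \<noteq> 0" using h(1) by auto
    have "sigma (act h' a) = sigma \<one>" using h(2) hc a(1) by (simp add: act_pCons)
    then have "act h' a = \<one>" using sigma_inj[of "act h' a" \<one>] a(1) by simp
    then show False using min[of h'] h' hc by simp
  qed
  \<comment> \<open>Otherwise \<open>1 - t\<close> splits off. The cofactor sends \<open>a\<close>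
    to an element commuting with \<open>x\<close>, hence to \<open>\<one>\<close>, again
    contradicting minimality.\<close>
  have h1: "poly h 1 \<noteq> 0"
  proof
    assume "poly h 1 = 0"
    then have "[:-1, 1:] dvd h" by (simp add: poly_eq_0_iff_dvd)
    then obtain h'' where h'': "h = [:-1, 1:] * h''" by (rule dvdE)
    define h' where "h' = - h''"
    have hh: "h = [:1, -1:] * h'" using h'' by (simp add: h'_def)
    have h': "h' \<noteq> 0" using h(1) hh by auto
    have "act [:1, -1:] (act h' a) = \<one>" using h(2) a(1) unfolding hh by (simp only: act_mult)
    then have "act h' a \<otimes> x \<otimes> inv (act h' a) \<otimes> inv x = \<one>"
      using a(1) by (simp only: act_one_minus_X act_closed)
    then have "act h' a \<otimes> x = x \<otimes> act h' a"
      using commutator_eq_one_iff[of "act h' a" x] a(1) by simp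
    then have "act h' a = \<one>" using fixpoint_free[of "act h' a"] a(1) by simp
    moreover have "Polynomial.degree h = Suc (Polynomial.degree h')"
      unfolding hh using h' by (subst degree_mult_eq) auto
    ultimately show False using min[of h'] h' by simp
  qed
  \<comment> \<open>A prime this large divides none of the three nonzero integers, as
    \<open>not_dvd_mult_minus_powers\<close> demands.\<close>
  obtain q :: nat where q: "Factorial_Ring.prime q" "q > nat (\<bar>lead_coeff h * poly h 0 * poly h 1\<bar>)"
    using bigger_prime by blast
  define p where "p = int q"
  have p: "Factorial_Ring.prime p" using q(1) by (simp add: p_def)
  have nd: "\<not> p dvd lead_coeff h * poly h 0 * poly h 1"
  proof
    assume "p dvd lead_coeff h * poly h 0 * poly h 1"
    moreover have "lead_coeff h * poly h 0 * poly h 1 \<noteq> 0" using h(1) h0 h1 by simp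
    ultimately have "\<bar>p\<bar> \<le> \<bar>lead_coeff h * poly h 0 * poly h 1\<bar>" by (rule dvd_imp_le_int[rotated])
    then show False using q(2) by (simp add: p_def)
  qed
  have nl: "\<not> p dvd lead_coeff h" and n0: "\<not> p dvd poly h 0" and n1: "\<not> p dvd poly h 1"
    using nd by (auto intro: dvd_mult dvd_mult2)
  have p0: "p \<noteq> 0" using p by auto
  let ?M = "cyc a"
  \<comment> \<open>In additive notation \<open>T\<close> is \<open>p M\<close>; it is nontrivial
    because \<open>A\<close> is assumed torsion-free.\<close>
  define T where "T = (\<lambda>m. m [^] p) ` ?M"
  have M: "?M \<lhd> G" by (rule cyc_normal[OF a])
  have MA: "m \<in> A" if "m \<in> ?M" for m using that by (rule cyc_subset)
  have "subgroup T G"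
  proof (rule subgroupI)
    show "T \<subseteq> carrier G" using MA by (auto simp: T_def)
    show "T \<noteq> {}" using cyc_self[OF a(1)] by (auto simp: T_def)
  next
    fix y assume "y \<in> T"
    then obtain m where m: "m \<in> ?M" "y = m [^] p" by (auto simp: T_def)
    have "inv y = inv m [^] p" using MA[OF m(1)] m(2) by (simp add: int_pow_inv)
    then show "inv y \<in> T" using cyc_inv[OF a(1) m(1)] by (simp add: T_def)
  next
    fix y z assume "y \<in> T" "z \<in> T"
    then obtain m n where m: "m \<in> ?M" "y = m [^] p" and n: "n \<in> ?M" "z = n [^] p"
      by (auto simp: T_def)
    have "y \<otimes> z = (m \<otimes> n) [^] p" using MA m n by (simp add: A_int_pow_distrib)
    then show "y \<otimes> z \<in> T" using cyc_mult[OF a(1) m(1) n(1)] by (simp add: T_def)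
  qed
  moreover have "g \<otimes> y \<otimes> inv g \<in> T" if g: "g \<in> carrier G" and y: "y \<in> T" for g y
  proof -
    obtain m where m: "m \<in> ?M" "y = m [^] p" using y by (auto simp: T_def)
    have "g \<otimes> y \<otimes> inv g = (g \<otimes> m \<otimes> inv g) [^] p" using g m MA by (simp add: conj_int_pow)
    moreover have "g \<otimes> m \<otimes> inv g \<in> ?M" by (rule normal.inv_op_closed2[OF M g m(1)])
    ultimately show ?thesis by (simp add: T_def)
  qed
  ultimately have T: "T \<lhd> G" by (simp add: normal_inv_iff)
  have "a [^] p \<in> T" using cyc_self[OF a(1)] by (simp add: T_def)
  moreover have "a [^] p \<noteq> \<one>" using tf[OF a] p0 by blast
  ultimately have "T \<noteq> {\<one>}" by auto
  then obtain n where "act ([:1, -1:] ^ n) a \<in> T" using act_in_normal[OF a(1) T] by blast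
  then obtain m where m: "m \<in> ?M" "act ([:1, -1:] ^ n) a = m [^] p" by (auto simp: T_def)
  obtain j g where g: "m \<in> A" "(sigma ^^ j) m = act g a" using m(1) by (auto simp: cyc_def)
  \<comment> \<open>Additively, \<open>(1 - t)^n a = p m\<close> and \<open>t^j m = g a\<close>
    combine into the relation \<open>k\<close>, which is congruent to \<open>t^j (1 - t)^n\<close>
    modulo \<open>p\<close>.\<close>
  define k where "k = [:0, 1:] ^ j * [:1, -1:] ^ n - Polynomial.smult p g"
  have "act ([:0, 1:] ^ j * [:1, -1:] ^ n) a = (sigma ^^ j) (m [^] p)"
    using a(1) by (simp add: act_mult act_X_power m(2)[symmetric])
  also have "\<dots> = act (Polynomial.smult p g) a"
    using a(1) g by (simp add: sigma_funpow_int_pow act_smult)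
  finally have k1: "act k a = \<one>" using a(1) by (simp add: k_def act_diff)
  \<comment> \<open>The remainder \<open>r\<close> kills \<open>a\<close>, so it vanishes by
    minimality of \<open>h\<close>. Hence \<open>h * d\<close> is congruent modulo \<open>p\<close>
    to \<open>C t^j (1 - t)^n\<close>, with \<open>C\<close> prime to \<open>p\<close>.\<close>
  obtain d r where qr: "pseudo_divmod k h = (d, r)" by (cases "pseudo_divmod k h")
  define C where "C = lead_coeff h ^ (Suc (Polynomial.degree k) - Polynomial.degree h)"
  have Ck: "Polynomial.smult C k = d * h + r"
    using pseudo_divmod(1)[OF h(1) qr] by (simp add: C_def mult.commute)
  have "act r a = act (d * h + r) a" using a(1) h(2) by (simp add: act_add act_mult)
  also have "\<dots> = \<one>" using a(1) k1 by (simp only: Ck[symmetric] act_smult int_pow_one)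
  finally have "act r a = \<one>" .
  then have "r = 0" using pseudo_divmod(2)[OF h(1) qr] min[of r] by fastforce
  then have "h * d - Polynomial.smult C ([:0, 1:] ^ j * [:1, -1:] ^ n) = [:p:] * Polynomial.smult (- C) g"
    using Ck by (simp add: k_def smult_diff_right mult.commute algebra_simps)
  then have "[:p:] dvd h * d - Polynomial.smult C ([:0, 1:] ^ j * [:1, -1:] ^ n)"
    by (rule dvdI)
  moreover have "\<not> p dvd C" unfolding C_def using nl p by (metis prime_dvd_power)
  ultimately show False using not_dvd_mult_minus_powers[OF p nl deg _ n0 n1] by blast
qed

text \<open>A suitable power of a nontrivial torsion element has prime order, the case already
  settled.\<close>

lemma finite_if_nontrivial:
  assumes "A \<noteq> {\<one>}"
  shows "finite (carrier G)"
proof -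
  obtain a where "a \<in> A" "a \<noteq> \<one>" using assms A_one by auto
  then obtain b and c :: int where b: "b \<in> A" "b \<noteq> \<one>" "c \<noteq> 0" "b [^] c = \<one>"
    using torsion_if_nontrivial by blast
  let ?Q = "\<lambda>n::nat. n > 0 \<and> b [^] int n = \<one>"
  have "b [^] \<bar>c\<bar> = \<one>" using b by (cases "c \<ge> 0") (simp_all add: int_pow_neg)
  then have "?Q (nat \<bar>c\<bar>)" using b(3) by simp
  then have n': "?Q (LEAST n. ?Q n)" by (rule LeastI)
  define n where "n = (LEAST n. ?Q n)"
  have n: "?Q n" using n' by (simp only: n_def)
  have least: "\<not> ?Q m" if "m < n" for m using that unfolding n_def by (rule not_less_Least)
  have "n \<noteq> 1" using n b(1,2) by auto
  then obtain q where q: "Factorial_Ring.prime q" "q dvd n" using prime_factor_nat by blast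
  then obtain m where m: "n = m * q" by (metis dvdE mult.commute)
  have "m > 0" "m < n" using n m prime_gt_1_nat[OF q(1)] by auto
  then have "b [^] int m \<noteq> \<one>" using least by blast
  moreover have "(b [^] int m) [^] int q = \<one>" using n m b(1) by (simp add: int_pow_pow)
  ultimately show ?thesis using finite_if_torsion[of "b [^] int m" "int q"] b(1) q(1) by simp
qed

end

text \<open>A consequence of the meta-nilpotent-Hamiltonian property that, unlike the property itself,
  passes to homomorphic images without comparing the nilpotency of subgroups.\<close>

definition engel_normal :: "('a, 'b) monoid_scheme \<Rightarrow> bool" where
  "engel_normal G \<longleftrightarrow> (\<forall>x\<in>carrier G. \<forall>y\<in>carrier G.
     (\<forall>n. ((\<lambda>z. z \<otimes>\<^bsub>G\<^esub> x \<otimes>\<^bsub>G\<^esub> inv\<^bsub>G\<^esub> z \<otimes>\<^bsub>G\<^esub> inv\<^bsub>G\<^esub> x) ^^ n) y \<noteq> \<one>\<^bsub>G\<^esub>) \<longrightarrow>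
     generate G {x, y} \<lhd> G)"

section \<open>Just non-nilpotent groups with a nontrivial abelian normal subgroup\<close>

context just_non_nilpotent
begin

text \<open>The task is to find an \<open>x\<close> for which \<open>A\<close> satisfies the
  assumptions of \<open>jnn_module\<close>.\<close>

theorem finite_if_abelian_normal:
  assumes A: "A \<lhd> G" "A \<noteq> {\<one>}" and comm: "\<And>a b. \<lbrakk>a \<in> A; b \<in> A\<rbrakk> \<Longrightarrow> a \<otimes> b = b \<otimes> a"
    and engel: "engel_normal G"
  shows "finite (carrier G)"
proof -
  let ?C = "centralizer A"
  have As: "A \<subseteq> carrier G" by (rule subgroup.subset[OF normal_imp_subgroup[OF A(1)]])
  have A1: "\<one> \<in> A" by (rule subgroup.one_closed[OF normal_imp_subgroup[OF A(1)]])
  have "A \<subseteq> ?C" using As comm by (auto simp: centralizer_def)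
  then have "?C \<noteq> {\<one>}" using A(2) A1 by blast
  then have ex: "\<exists>n. lower_central G n \<subseteq> ?C"
    using lower_central_le_normal[OF centralizer_normal[OF A(1)]] by blast
  \<comment> \<open>\<open>x\<close> will come from the last term not contained in
    \<open>?C\<close>, so that its commutators with all group elements centralise
    \<open>A\<close>.\<close>
  define n where "n = (LEAST n. lower_central G n \<subseteq> ?C)"
  have n: "lower_central G n \<subseteq> ?C" unfolding n_def using ex by (rule LeastI_ex)
  \<comment> \<open>If the whole group centralised \<open>A\<close>, then \<open>A\<close> would be
    central, hence trivial.\<close>
  have "n \<noteq> 0"
  proof
    assume "n = 0"
    then have C: "carrier G \<subseteq> ?C" using n by simp
    have "a = \<one>" if a: "a \<in> A" for a
    proof (rule center_trivial)
      show "a \<in> carrier G" using a As by blast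
      fix g assume "g \<in> carrier G"
      then have "g \<in> ?C" using C by blast
      then show "a \<otimes> g = g \<otimes> a" using a by (simp add: centralizer_def)
    qed
    then show False using A(2) A1 by blast
  qed
  then obtain m where m: "n = Suc m" by (cases n) auto
  have "\<not> lower_central G m \<subseteq> ?C" unfolding n_def[symmetric]
    using not_less_Least[of m "\<lambda>n. lower_central G n \<subseteq> ?C"] m by (simp add: n_def)
  then obtain x where x: "x \<in> lower_central G m" "x \<notin> ?C" by blast
  have xc: "x \<in> carrier G" using x(1) lower_central_subset by blast
  have xg: "x \<otimes> g \<otimes> inv x \<otimes> inv g \<in> ?C" if "g \<in> carrier G" for g
    using commutator_in_lower_central[OF x(1) that] n m by blast
  interpret conj_module G A x
    by (intro conj_module.intro conj_module_axioms.intro is_group A(1) comm xc)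
  \<comment> \<open>The commutator of \<open>x\<close> and \<open>g\<close> acts trivially on
    \<open>A\<close>, so the products of \<open>x\<close> and \<open>g\<close> in either order act
    alike.\<close>
  have sigma_conj: "sigma (g \<otimes> a \<otimes> inv g) = g \<otimes> sigma a \<otimes> inv g"
    if g: "g \<in> carrier G" and a: "a \<in> A" for g a
  proof -
    let ?c = "x \<otimes> g \<otimes> inv x \<otimes> inv g" and ?b = "g \<otimes> sigma a \<otimes> inv g"
    have ac: "a \<in> carrier G" using a by simp
    have b: "?b \<in> A" using a g by simp
    have "?c \<otimes> ?b = ?b \<otimes> ?c" using xg[OF g] b by (simp add: centralizer_def)
    then have "?c \<otimes> ?b \<otimes> inv ?c = ?b" using b g xc by (simp add: inv_solve_right')
    moreover have "?c \<otimes> ?b \<otimes> inv ?c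
        = x \<otimes> g \<otimes> inv x \<otimes> (inv g \<otimes> g) \<otimes> x \<otimes> a \<otimes> inv x \<otimes> (inv g \<otimes> g) \<otimes> x \<otimes> inv g \<otimes> inv x"
      using g ac xc by (simp only: sigma_def inv_mult_group inv_inv m_assoc m_closed inv_closed)
    moreover have "\<dots> = x \<otimes> g \<otimes> (inv x \<otimes> x) \<otimes> a \<otimes> (inv x \<otimes> x) \<otimes> inv g \<otimes> inv x"
      using g ac xc by (simp only: l_inv r_one m_assoc m_closed inv_closed l_one)
    moreover have "\<dots> = sigma (g \<otimes> a \<otimes> inv g)"
      using g ac xc by (simp add: sigma_def m_assoc)
    ultimately show ?thesis by simp
  qed
  \<comment> \<open>This is \<open>1 - t\<close> on \<open>A\<close>; its kernel consists of the
    fixed points of \<open>sigma\<close>.\<close>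
  define d where "d a = a \<otimes> inv (sigma a)" for a
  have dA: "d a \<in> A" if "a \<in> A" for a using that by (simp add: d_def)
  have d1: "d a = \<one> \<longleftrightarrow> sigma a = a" if "a \<in> A" for a
  proof -
    have "d a = \<one> \<longleftrightarrow> a = \<one> \<otimes> sigma a" unfolding d_def
      using that by (intro inv_solve_right') simp_all
    then show ?thesis using that by auto
  qed
  have comm_eq: "a \<otimes> g \<otimes> inv a \<otimes> inv g = a \<otimes> inv (g \<otimes> a \<otimes> inv g)"
    if "a \<in> A" "g \<in> carrier G" for a g
    using that by (simp add: inv_mult_group m_assoc)
  have dcomm: "d (a \<otimes> g \<otimes> inv a \<otimes> inv g) = d a \<otimes> g \<otimes> inv (d a) \<otimes> inv g"
    if a: "a \<in> A" and g: "g \<in> carrier G" for a g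
  proof -
    let ?f = "\<lambda>a. g \<otimes> a \<otimes> inv g"
    have fA: "?f b \<in> A" if "b \<in> A" for b using that g by simp
    have inv_distr: "inv (b \<otimes> inv c) = inv b \<otimes> c" if "b \<in> A" "c \<in> A" for b c
      using that by (simp add: inv_mult_group A_comm)
    have f_distr: "?f (b \<otimes> inv c) = ?f b \<otimes> inv (?f c)" if "b \<in> A" "c \<in> A" for b c
    proof -
      interpret h: group_hom G G ?f
        by (intro group_hom.intro group_hom_axioms.intro is_group conj_hom[OF g])
      show ?thesis using that h.hom_mult[of b "inv c"] h.hom_inv[of c] by simp
    qed
    have "d (a \<otimes> g \<otimes> inv a \<otimes> inv g) = d (a \<otimes> inv (?f a))" using a g by (simp only: comm_eq)
    also have "\<dots> = a \<otimes> inv (?f a) \<otimes> inv (sigma a \<otimes> inv (sigma (?f a)))"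
      using a fA by (simp only: d_def sigma_mult sigma_inv A_inv)
    also have "\<dots> = a \<otimes> inv (?f a) \<otimes> (inv (sigma a) \<otimes> ?f (sigma a))"
      using a g by (simp only: sigma_conj inv_distr sigma_closed fA)
    also have "\<dots> = a \<otimes> inv (sigma a) \<otimes> (inv (?f a) \<otimes> ?f (sigma a))"
      using a fA by (simp only: A_ac A_carrier A_inv A_mult sigma_closed)
    also have "\<dots> = d a \<otimes> inv (?f (d a))"
      using a fA by (simp only: d_def f_distr inv_distr sigma_closed)
    also have "\<dots> = d a \<otimes> g \<otimes> inv (d a) \<otimes> inv g" using dA[OF a] g by (simp only: comm_eq)
    finally show ?thesis .
  qed
  \<comment> \<open>\<open>d\<close> commutes with taking commutators with \<open>g\<close>, and \<open>d a \<noteq> \<one>\<close> is never central.\<close>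
  have deep: "\<exists>a\<in>A. a \<in> lower_central G n \<and> d a \<noteq> \<one>" for n
  proof (induction n)
    case 0
    have "\<exists>a\<in>A. x \<otimes> a \<noteq> a \<otimes> x" using x(2) xc by (auto simp: centralizer_def)
    then obtain a where a: "a \<in> A" "x \<otimes> a \<noteq> a \<otimes> x" by blast
    then have "sigma a \<noteq> a" by (simp add: sigma_def inv_solve_right')
    then show ?case using a(1) d1[OF a(1)] by (intro bexI[of _ a]) simp_all
  next
    case (Suc n)
    then obtain a where a: "a \<in> A" "a \<in> lower_central G n" "d a \<noteq> \<one>" by blast
    have "d a \<in> carrier G" using dA[OF a(1)] by simp
    then obtain g where g: "g \<in> carrier G" "d a \<otimes> g \<otimes> inv (d a) \<otimes> inv g \<noteq> \<one>"
      using exists_nontrivial_commutator[of "d a"] a(3) by blast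
    show ?case
    proof (intro bexI conjI)
      show "d (a \<otimes> g \<otimes> inv a \<otimes> inv g) \<noteq> \<one>" using dcomm[OF a(1) g(1)] g(2) by simp
      show "a \<otimes> g \<otimes> inv a \<otimes> inv g \<in> lower_central G (Suc n)"
        by (rule commutator_in_lower_central[OF a(2) g(1)])
      show "a \<otimes> g \<otimes> inv a \<otimes> inv g \<in> A" by (rule commutator_in_normal[OF A(1) a(1) g(1)])
    qed
  qed
  define K where "K = {a \<in> A. sigma a = a}"
  have "subgroup K G"
  proof (rule subgroupI)
    have "\<one> \<in> K" by (simp add: K_def)
    then show "K \<noteq> {}" by blast
  qed (auto simp: K_def sigma_inv sigma_mult)
  then have K: "K \<lhd> G" by (auto simp: normal_inv_iff K_def sigma_conj)
  \<comment> \<open>By \<open>deep\<close> every term of the lower central series has an element of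
    \<open>A\<close> moved by \<open>sigma\<close>, so no term lies in \<open>K\<close>.\<close>
  have K1: "K = {\<one>}"
  proof (rule ccontr)
    assume "K \<noteq> {\<one>}"
    then obtain k where "lower_central G k \<subseteq> K" using lower_central_le_normal[OF K] by blast
    then show False using deep[of k] d1 by (auto simp: K_def)
  qed
  have free: "y = \<one>" if "y \<in> A" "x \<otimes> y = y \<otimes> x" for y
  proof -
    have "sigma y = y" using that by (simp add: sigma_def inv_solve_right')
    then have "y \<in> K" using that(1) by (simp add: K_def)
    then show ?thesis using K1 by simp
  qed
  have gen: "generate G {x, a} \<lhd> G" if a: "a \<in> A" "a \<noteq> \<one>" for a
  proof -
    \<comment> \<open>As only the identity of \<open>A\<close> commutes with \<open>x\<close>,
      repeated commutators of \<open>a\<close> with \<open>x\<close> never become trivial, and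
      \<open>engel\<close> applies.\<close>
    have "((\<lambda>z. z \<otimes> x \<otimes> inv z \<otimes> inv x) ^^ n) a \<in> A - {\<one>}" for n
    proof (induction n)
      case (Suc n)
      let ?z = "((\<lambda>z. z \<otimes> x \<otimes> inv z \<otimes> inv x) ^^ n) a"
      have z: "?z \<in> A" "?z \<noteq> \<one>" using Suc by blast+
      have "?z \<otimes> x \<otimes> inv ?z \<otimes> inv x \<in> A" by (rule commutator_in_normal[OF A(1) z(1) xc])
      moreover have "?z \<otimes> x \<otimes> inv ?z \<otimes> inv x \<noteq> \<one>"
      proof
        assume "?z \<otimes> x \<otimes> inv ?z \<otimes> inv x = \<one>"
        then have "?z \<otimes> x = x \<otimes> ?z" using z(1) xc commutator_eq_one_iff[of ?z x] by simp
        then show False using free[OF z(1)] z(2) by simp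
      qed
      ultimately show ?case by simp
    qed (use a in simp)
    then have "((\<lambda>z. z \<otimes> x \<otimes> inv z \<otimes> inv x) ^^ n) a \<noteq> \<one>" for n by blast
    then show ?thesis
      by (rule engel[unfolded engel_normal_def, rule_format, OF xc A_carrier[OF a(1)]])
  qed
  interpret jnn_module G A x
    by (intro jnn_module.intro jnn_module_axioms.intro just_non_nilpotent_axioms conj_module_axioms free gen)
  show ?thesis using A(2) by (rule finite_if_nontrivial)
qed

end

text \<open>The \<open>n\<close>-th iterated commutator lies in the \<open>n\<close>-th lower
  central term of the subgroup generated by \<open>x\<close> and \<open>y\<close>, which is thus not
  nilpotent if none of them is trivial.\<close>

lemma (in group) engel_normal_if_meta_Nil_Hamiltonian:
  assumes "meta_Nil_Hamiltonian G"
  shows "engel_normal G"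
  unfolding engel_normal_def
proof (intro ballI impI)
  fix x y assume xy: "x \<in> carrier G" "y \<in> carrier G"
    and ne: "\<forall>n. ((\<lambda>z. z \<otimes> x \<otimes> inv z \<otimes> inv x) ^^ n) y \<noteq> \<one>"
  let ?X = "generate G {x, y}"
  let ?GX = "G\<lparr>carrier := ?X\<rparr>"
  have X: "subgroup ?X G" using xy by (intro generate_is_subgroup) simp
  interpret X: group ?GX using X by (rule subgroup.subgroup_is_group) (rule is_group)
  have xX: "x \<in> ?X" and yX: "y \<in> ?X" by (auto intro: generate.incl)
  have "((\<lambda>z. z \<otimes> x \<otimes> inv z \<otimes> inv x) ^^ n) y \<in> lower_central ?GX n" for n
  proof (induction n)
    case (Suc n)
    let ?z = "((\<lambda>z. z \<otimes> x \<otimes> inv z \<otimes> inv x) ^^ n) y"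
    have "?z \<in> ?X" using Suc X.lower_central_subset[of n] by auto
    then have "?z \<otimes> x \<otimes> inv ?z \<otimes> inv x \<in> lower_central ?GX (Suc n)"
      using X.commutator_in_lower_central[OF Suc, of x] X xX by simp
    then show ?case by simp
  qed (use yX in simp)
  then have "lower_central ?GX n \<noteq> {\<one>}" for n using ne by blast
  then have "\<not> nilpotent_group ?GX" by (simp add: nilpotent_group_def)
  then show "?X \<lhd> G" using assms X by (simp add: meta_Nil_Hamiltonian_def)
qed

lemma (in group) meta_Nil_Hamiltonian_subgroup:
  assumes "meta_Nil_Hamiltonian G" "subgroup H G"
  shows "meta_Nil_Hamiltonian (G\<lparr>carrier := H\<rparr>)"
  unfolding meta_Nil_Hamiltonian_def
proof (intro conjI allI impI)
  show "group (G\<lparr>carrier := H\<rparr>)" using assms(2) is_group by (rule subgroup.subgroup_is_group)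
  fix U assume U: "subgroup U (G\<lparr>carrier := H\<rparr>) \<and> \<not> nilpotent_group (G\<lparr>carrier := H\<rparr>\<lparr>carrier := U\<rparr>)"
  then have "subgroup U G" using incl_subgroup[OF assms(2)] by blast
  moreover have "\<not> nilpotent_group (G\<lparr>carrier := U\<rparr>)" using U by simp
  ultimately have "U \<lhd> G" using assms(1) by (simp add: meta_Nil_Hamiltonian_def)
  moreover have "U \<subseteq> H" using U subgroup.subset by fastforce
  ultimately show "U \<lhd> G\<lparr>carrier := H\<rparr>" using assms(2) normal_restrict_supergroup by blast
qed

section \<open>Homomorphic images and quotients\<close>

context group_hom
begin

lemma lower_central_image:
  assumes surj: "h ` carrier G = carrier H"
  shows "h ` lower_central G n = lower_central H n"
proof (induction n)
  case 0
  then show ?case using surj by simp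
next
  case (Suc n)
  let ?g = "lower_central G n"
  have gs: "?g \<subseteq> carrier G" by (rule G.lower_central_subset)
  have sub: "commutator_set G ?g (carrier G) \<subseteq> carrier G"
    using gs by (auto simp: commutator_set_def)
  have hc: "h (a \<otimes> b \<otimes> inv a \<otimes> inv b) = h a \<otimes>\<^bsub>H\<^esub> h b \<otimes>\<^bsub>H\<^esub> inv\<^bsub>H\<^esub> (h a) \<otimes>\<^bsub>H\<^esub> inv\<^bsub>H\<^esub> (h b)"
    if "a \<in> carrier G" "b \<in> carrier G" for a b
    using that by simp
  have "h ` commutator_set G ?g (carrier G) = commutator_set H (h ` ?g) (h ` carrier G)"
  proof
    show "h ` commutator_set G ?g (carrier G) \<subseteq> commutator_set H (h ` ?g) (h ` carrier G)"
    proof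
      fix y assume "y \<in> h ` commutator_set G ?g (carrier G)"
      then obtain a b where ab: "a \<in> ?g" "b \<in> carrier G" "y = h (a \<otimes> b \<otimes> inv a \<otimes> inv b)"
        by (auto simp: commutator_set_def)
      then have "y = h a \<otimes>\<^bsub>H\<^esub> h b \<otimes>\<^bsub>H\<^esub> inv\<^bsub>H\<^esub> (h a) \<otimes>\<^bsub>H\<^esub> inv\<^bsub>H\<^esub> (h b)" using hc gs by blast
      then show "y \<in> commutator_set H (h ` ?g) (h ` carrier G)"
        using ab by (auto simp: commutator_set_def)
    qed
    show "commutator_set H (h ` ?g) (h ` carrier G) \<subseteq> h ` commutator_set G ?g (carrier G)"
    proof
      fix y assume "y \<in> commutator_set H (h ` ?g) (h ` carrier G)"
      then obtain a b where ab: "a \<in> ?g" "b \<in> carrier G"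
        "y = h a \<otimes>\<^bsub>H\<^esub> h b \<otimes>\<^bsub>H\<^esub> inv\<^bsub>H\<^esub> (h a) \<otimes>\<^bsub>H\<^esub> inv\<^bsub>H\<^esub> (h b)"
        by (auto simp: commutator_set_def)
      then have "y = h (a \<otimes> b \<otimes> inv a \<otimes> inv b)" using hc[of a b] gs by auto
      moreover have "a \<otimes> b \<otimes> inv a \<otimes> inv b \<in> commutator_set G ?g (carrier G)"
        using ab by (auto simp: commutator_set_def)
      ultimately show "y \<in> h ` commutator_set G ?g (carrier G)" by blast
    qed
  qed
  then show ?case using Suc surj generate_img[OF sub] by simp
qed

lemma normal_image:
  assumes "h ` carrier G = carrier H" "N \<lhd> G"
  shows "h ` N \<lhd> H"
  using normal.surj_hom_normal_subgroup[OF assms(2) group_hom_axioms assms(1)] .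

lemma normal_preimage:
  assumes N: "N \<lhd> H"
  shows "{g \<in> carrier G. h g \<in> N} \<lhd> G"
proof -
  have Ns: "subgroup N H" using N by (rule normal_imp_subgroup)
  have "subgroup {g \<in> carrier G. h g \<in> N} G"
  proof (rule G.subgroupI)
    have "\<one> \<in> {g \<in> carrier G. h g \<in> N}" using Ns by (simp add: subgroup.one_closed)
    then show "{g \<in> carrier G. h g \<in> N} \<noteq> {}" by blast
  qed (auto simp: Ns subgroup.m_inv_closed subgroup.m_closed)
  then show ?thesis using N by (auto simp: G.normal_inv_iff normal.inv_op_closed2)
qed

text \<open>Iterated commutators of preimages map to those of \<open>x\<close> and \<open>y\<close>,
  so they are nontrivial as well; the normal subgroup generated by the preimages maps onto the
  required one.\<close>

lemma engel_normal_image: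
  assumes surj: "h ` carrier G = carrier H" and engel: "engel_normal G"
  shows "engel_normal H"
  unfolding engel_normal_def
proof (intro ballI impI)
  fix x y assume xy: "x \<in> carrier H" "y \<in> carrier H"
    and ne: "\<forall>n. ((\<lambda>z. z \<otimes>\<^bsub>H\<^esub> x \<otimes>\<^bsub>H\<^esub> inv\<^bsub>H\<^esub> z \<otimes>\<^bsub>H\<^esub> inv\<^bsub>H\<^esub> x) ^^ n) y \<noteq> \<one>\<^bsub>H\<^esub>"
  have "x \<in> h ` carrier G" "y \<in> h ` carrier G" using xy by (simp_all only: surj)
  then obtain u v where u: "u \<in> carrier G" "h u = x" and v: "v \<in> carrier G" "h v = y" by auto
  note uv = u v
  let ?e = "\<lambda>n. ((\<lambda>z. z \<otimes> u \<otimes> inv z \<otimes> inv u) ^^ n) v"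
  have e: "?e n \<in> carrier G \<and> h (?e n) = ((\<lambda>z. z \<otimes>\<^bsub>H\<^esub> x \<otimes>\<^bsub>H\<^esub> inv\<^bsub>H\<^esub> z \<otimes>\<^bsub>H\<^esub> inv\<^bsub>H\<^esub> x) ^^ n) y" for n
    by (induction n) (use uv in auto)
  have "?e n \<noteq> \<one>" for n
  proof
    assume "?e n = \<one>"
    then have "h (?e n) = \<one>\<^bsub>H\<^esub>" by simp
    then show False using e[of n] ne by simp
  qed
  then have "generate G {u, v} \<lhd> G"
    by (rule engel[unfolded engel_normal_def, rule_format, OF u(1) v(1)])
  then have "h ` generate G {u, v} \<lhd> H" by (rule normal_image[OF surj])
  moreover have "h ` generate G {u, v} = generate H (h ` {u, v})" using uv by (intro generate_img[symmetric]) simp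
  ultimately show "generate H {x, y} \<lhd> H" using uv by simp
qed

end

context normal
begin

lemma quotient_group_hom: "group_hom G (G Mod H) (\<lambda>a. H #> a)"
  using factorgroup_is_group r_coset_hom_Mod is_group
  by (simp add: group_hom_def group_hom_axioms_def)

lemma quotient_surj: "(\<lambda>a. H #> a) ` carrier G = carrier (G Mod H)"
  by (auto simp: carrier_FactGroup)

lemma quotient_eq_one_iff: "g \<in> carrier G \<Longrightarrow> H #> g = \<one>\<^bsub>G Mod H\<^esub> \<longleftrightarrow> g \<in> H"
  using coset_join1[of H g] coset_join2[of g H] subgroup_axioms by (auto simp: subset)

lemma quotient_commute_iff:
  assumes "a \<in> carrier G" "b \<in> carrier G"
  shows "(H #> a) \<otimes>\<^bsub>G Mod H\<^esub> (H #> b) = (H #> b) \<otimes>\<^bsub>G Mod H\<^esub> (H #> a)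
    \<longleftrightarrow> a \<otimes> b \<otimes> inv a \<otimes> inv b \<in> H"
proof -
  interpret q: group_hom G "G Mod H" "\<lambda>a. H #> a" by (rule quotient_group_hom)
  let ?Q = "G Mod H"
  have "a \<otimes> b \<otimes> inv a \<otimes> inv b \<in> H \<longleftrightarrow> H #> (a \<otimes> b \<otimes> inv a \<otimes> inv b) = \<one>\<^bsub>?Q\<^esub>"
    using assms quotient_eq_one_iff[of "a \<otimes> b \<otimes> inv a \<otimes> inv b"] by simp
  also have "H #> (a \<otimes> b \<otimes> inv a \<otimes> inv b)
      = (H #> a) \<otimes>\<^bsub>?Q\<^esub> (H #> b) \<otimes>\<^bsub>?Q\<^esub> inv\<^bsub>?Q\<^esub> (H #> a) \<otimes>\<^bsub>?Q\<^esub> inv\<^bsub>?Q\<^esub> (H #> b)"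
    using assms by (simp only: q.hom_mult q.hom_inv m_closed inv_closed)
  also have "\<dots> = \<one>\<^bsub>?Q\<^esub> \<longleftrightarrow> (H #> a) \<otimes>\<^bsub>?Q\<^esub> (H #> b) = (H #> b) \<otimes>\<^bsub>?Q\<^esub> (H #> a)"
    using assms by (intro q.H.commutator_eq_one_iff q.hom_closed)
  finally show ?thesis by blast
qed

end

section \<open>Just non-nilpotent quotients\<close>

text \<open>When \<open>S\<close> generates the group, the \<open>n\<close>-th set generates
  \<open>lower_central G n\<close> as a normal subgroup; it is finite whenever \<open>S\<close>
  is.\<close>

fun left_normed_commutators :: "('a, 'b) monoid_scheme \<Rightarrow> 'a set \<Rightarrow> nat \<Rightarrow> 'a set" where
  "left_normed_commutators G S 0 = S"
| "left_normed_commutators G S (Suc n) = commutator_set G (left_normed_commutators G S n) S"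

lemma finite_left_normed_commutators: "finite S \<Longrightarrow> finite (left_normed_commutators G S n)"
  by (induction n) (auto simp: commutator_set_def)

context group
begin

lemma left_normed_commutators_subset:
  assumes "S \<subseteq> carrier G"
  shows "left_normed_commutators G S n \<subseteq> lower_central G n"
proof (induction n)
  case (Suc n)
  have "commutator_set G (left_normed_commutators G S n) S
      \<subseteq> commutator_set G (lower_central G n) (carrier G)"
    using Suc assms by (fastforce simp: commutator_set_def)
  then show ?case by (auto intro: generate.incl)
qed (use assms in simp)

text \<open>Modulo \<open>T\<close> the commutators of the preceding stage commute with the
  generators, so they are central. The induction hypothesis applies to the preimage of that centre,
  hence the arbitrary \<open>T\<close>.\<close>

lemma lower_central_subset_normal:
  assumes S: "S \<subseteq> carrier G" "generate G S = carrier G"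
    and T: "T \<lhd> G" and sub: "left_normed_commutators G S n \<subseteq> T"
  shows "lower_central G n \<subseteq> T"
  using T sub
proof (induction n arbitrary: T)
  case 0
  then have "generate G S \<subseteq> T" by (intro generate_subgroup_incl normal_imp_subgroup) simp_all
  then show ?case using S(2) by simp
next
  case (Suc n)
  interpret T: normal T G by (rule Suc.prems(1))
  interpret q: group_hom G "G Mod T" "\<lambda>a. T #> a" by (rule T.quotient_group_hom)
  let ?Q = "G Mod T" and ?q = "\<lambda>a. T #> a"
  let ?Z = "q.H.centralizer (carrier ?Q)"
  \<comment> \<open>the preimage of the centre of \<open>G Mod T\<close>\<close>
  define T' where "T' = {g \<in> carrier G. ?q g \<in> ?Z}"
  have T': "T' \<lhd> G" unfolding T'_def
    by (rule q.normal_preimage) (intro q.H.centralizer_normal q.H.normal_self)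
  have qS: "?q ` S \<subseteq> carrier ?Q" using S(1) q.hom_closed by blast
  have "generate ?Q (?q ` S) = carrier ?Q"
    using q.generate_img[OF S(1)] S(2) T.quotient_surj by simp
  then have Z: "?Z = q.H.centralizer (?q ` S)" using q.H.centralizer_generate[OF qS] by simp
  have "left_normed_commutators G S n \<subseteq> T'"
  proof
    fix c assume c: "c \<in> left_normed_commutators G S n"
    have cc: "c \<in> carrier G"
      using c left_normed_commutators_subset[OF S(1)] lower_central_subset by blast
    have "?q c \<otimes>\<^bsub>?Q\<^esub> ?q s = ?q s \<otimes>\<^bsub>?Q\<^esub> ?q c" if s: "s \<in> S" for s
    proof -
      have "c \<otimes> s \<otimes> inv c \<otimes> inv s \<in> left_normed_commutators G S (Suc n)"
        using c s by (auto simp: commutator_set_def)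
      then have "c \<otimes> s \<otimes> inv c \<otimes> inv s \<in> T" using Suc.prems(2) by blast
      moreover have "s \<in> carrier G" using s S(1) by blast
      ultimately show ?thesis using T.quotient_commute_iff[OF cc] by blast
    qed
    then have "?q c \<in> q.H.centralizer (?q ` S)"
      using q.hom_closed[OF cc] by (auto simp: q.H.centralizer_def)
    then show "c \<in> T'" using cc Z by (simp add: T'_def)
  qed
  then have IH: "lower_central G n \<subseteq> T'" by (rule Suc.IH[OF T'])
  show ?case
  proof (rule lower_central_Suc_subset)
    show "subgroup T G" by (rule T.subgroup_axioms)
    fix y g assume y: "y \<in> lower_central G n" and g: "g \<in> carrier G"
    have "y \<in> T'" using y IH by blast
    then have "y \<in> carrier G" "?q y \<otimes>\<^bsub>?Q\<^esub> ?q g = ?q g \<otimes>\<^bsub>?Q\<^esub> ?q y"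
      using q.hom_closed[OF g] by (simp_all add: T'_def q.H.centralizer_def)
    then show "y \<otimes> g \<otimes> inv y \<otimes> inv g \<in> T" using T.quotient_commute_iff[OF _ g] by blast
  qed
qed

lemma normal_Union_chain:
  assumes ne: "\<C> \<noteq> {}" and N: "\<And>N. N \<in> \<C> \<Longrightarrow> N \<lhd> G"
    and chain: "\<And>M N. \<lbrakk>M \<in> \<C>; N \<in> \<C>\<rbrakk> \<Longrightarrow> M \<subseteq> N \<or> N \<subseteq> M"
  shows "\<Union>\<C> \<lhd> G"
proof -
  have sg: "subgroup N G" if "N \<in> \<C>" for N using N[OF that] by (rule normal_imp_subgroup)
  have "subgroup (\<Union>\<C>) G"
  proof (rule subgroupI)
    show "\<Union>\<C> \<subseteq> carrier G" using sg subgroup.subset by blast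
    obtain N where "N \<in> \<C>" using ne by blast
    then have "\<one> \<in> \<Union>\<C>" using subgroup.one_closed[OF sg] by blast
    then show "\<Union>\<C> \<noteq> {}" by blast
  next
    fix a assume "a \<in> \<Union>\<C>"
    then obtain N where "N \<in> \<C>" "a \<in> N" by blast
    then show "inv a \<in> \<Union>\<C>" using subgroup.m_inv_closed[OF sg] by blast
  next
    fix a b assume "a \<in> \<Union>\<C>" "b \<in> \<Union>\<C>"
    then obtain M N where MN: "M \<in> \<C>" "a \<in> M" "N \<in> \<C>" "b \<in> N" by blast
    then obtain L where "L \<in> \<C>" "a \<in> L" "b \<in> L" using chain[OF MN(1,3)] by blast
    then show "a \<otimes> b \<in> \<Union>\<C>" using subgroup.m_closed[OF sg] by blast
  qed
  moreover have "g \<otimes> a \<otimes> inv g \<in> \<Union>\<C>" if g: "g \<in> carrier G" and a: "a \<in> \<Union>\<C>" for g a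
  proof -
    obtain N' where N': "N' \<in> \<C>" "a \<in> N'" using a by blast
    then show ?thesis using normal.inv_op_closed2[OF N[OF N'(1)] g N'(2)] by blast
  qed
  ultimately show ?thesis by (simp add: normal_inv_iff)
qed

lemma exists_just_non_nilpotent_quotient:
  assumes S: "finite S" "S \<subseteq> carrier G" "generate G S = carrier G"
    and nn: "\<not> nilpotent_group G"
  shows "\<exists>K. K \<lhd> G \<and> just_non_nilpotent (G Mod K)"
proof -
  let ?A = "{K. K \<lhd> G \<and> (\<forall>n. \<not> lower_central G n \<subseteq> K)}"
  have "{\<one>} \<in> ?A"
  proof -
    have "\<not> lower_central G n \<subseteq> {\<one>}" for n
      using nn one_in_lower_central[of n] is_group unfolding nilpotent_group_def by blast
    then show ?thesis using one_is_normal by blast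
  qed
  then have Ane: "?A \<noteq> {}" by blast
  have "\<exists>M\<in>?A. \<forall>K\<in>?A. M \<subseteq> K \<longrightarrow> K = M"
  proof (rule subset_Zorn_nonempty[OF Ane])
    fix \<C> assume ne: "\<C> \<noteq> {}" and ch: "subset.chain ?A \<C>"
    have CA: "\<C> \<subseteq> ?A" and tot: "\<And>M N. \<lbrakk>M \<in> \<C>; N \<in> \<C>\<rbrakk> \<Longrightarrow> M \<subseteq> N \<or> N \<subseteq> M"
      using ch unfolding subset_chain_def by blast+
    have U: "\<Union>\<C> \<lhd> G" using CA by (intro normal_Union_chain ne tot) blast+
    \<comment> \<open>Were a term inside the union, its finitely many commutators of generators
      would lie in a single member of the chain, and so would the term.\<close>
    have "\<not> lower_central G n \<subseteq> \<Union>\<C>" for n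
    proof
      assume "lower_central G n \<subseteq> \<Union>\<C>"
      then have "left_normed_commutators G S n \<subseteq> \<Union>\<C>"
        using left_normed_commutators_subset[OF S(2)] by (rule order_trans[rotated])
      moreover have "finite (left_normed_commutators G S n)"
        by (rule finite_left_normed_commutators[OF S(1)])
      ultimately obtain K where K: "K \<in> \<C>" "left_normed_commutators G S n \<subseteq> K"
        using finite_subset_Union_chain[OF _ _ ne ch] by blast
      have "K \<lhd> G" "\<not> lower_central G n \<subseteq> K" using K(1) CA by blast+
      then show False using lower_central_subset_normal[OF S(2,3) _ K(2)] by blast
    qed
    then show "\<Union>\<C> \<in> ?A" using U by blast
  qed
  then obtain K where K: "K \<lhd> G" "\<And>n. \<not> lower_central G n \<subseteq> K"
    and max': "\<forall>N\<in>?A. K \<subseteq> N \<longrightarrow> N = K"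
    by auto
  have max: "N = K" if "N \<lhd> G" "\<not> (\<exists>n. lower_central G n \<subseteq> N)" "K \<subseteq> N" for N
    using max' that by simp
  interpret K: normal K G by (rule K(1))
  interpret q: group_hom G "G Mod K" "\<lambda>a. K #> a" by (rule K.quotient_group_hom)
  let ?Q = "G Mod K" and ?q = "\<lambda>a. K #> a"
  have img: "lower_central ?Q n = ?q ` lower_central G n" for n
    using q.lower_central_image[OF K.quotient_surj] by simp
  have "just_non_nilpotent ?Q"
  proof (intro just_non_nilpotent.intro just_non_nilpotent_axioms.intro q.H.is_group)
    fix n
    obtain y where y: "y \<in> lower_central G n" "y \<notin> K" using K(2) by blast
    have "y \<in> carrier G" using y(1) lower_central_subset by blast
    then have "?q y \<noteq> \<one>\<^bsub>?Q\<^esub>" using K.quotient_eq_one_iff[of y] y(2) by blast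
    moreover have "?q y \<in> lower_central ?Q n" unfolding img using y(1) by (rule imageI)
    ultimately show "lower_central ?Q n \<noteq> {\<one>\<^bsub>?Q\<^esub>}" by auto
  next
    fix T assume T: "T \<lhd> ?Q" "T \<noteq> {\<one>\<^bsub>?Q\<^esub>}"
    \<comment> \<open>If this preimage contained no term, maximality would make it equal to
      \<open>K\<close>, and \<open>T\<close> would be trivial.\<close>
    let ?N = "{g \<in> carrier G. ?q g \<in> T}"
    have T1: "\<one>\<^bsub>?Q\<^esub> \<in> T" and Tc: "T \<subseteq> carrier ?Q"
      using subgroup.one_closed[OF normal_imp_subgroup[OF T(1)]]
        subgroup.subset[OF normal_imp_subgroup[OF T(1)]] by simp_all
    have "\<exists>n. lower_central G n \<subseteq> ?N"
    proof (rule ccontr)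
      assume no: "\<not> ?thesis"
      have "K \<subseteq> ?N"
      proof
        fix k assume "k \<in> K"
        then have k: "k \<in> carrier G" "?q k = \<one>\<^bsub>?Q\<^esub>"
          using K.quotient_eq_one_iff[of k] K.mem_carrier[of k] by blast+
        show "k \<in> ?N" using k(1) T1 unfolding k(2)[symmetric] by simp
      qed
      then have NK: "?N = K" by (rule max[OF q.normal_preimage[OF T(1)] no])
      have "t = \<one>\<^bsub>?Q\<^esub>" if t: "t \<in> T" for t
      proof -
        have "t \<in> ?q ` carrier G" unfolding K.quotient_surj using t Tc by blast
        then obtain g where g: "g \<in> carrier G" "t = ?q g" by blast
        then have "g \<in> ?N" using t by simp
        then have "g \<in> K" unfolding NK .
        then show ?thesis using K.quotient_eq_one_iff[OF g(1)] g(2) by simp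
      qed
      then show False using T(2) T1 by blast
    qed
    then obtain n where "lower_central G n \<subseteq> ?N" by blast
    then have "lower_central ?Q n \<subseteq> T" unfolding img by blast
    then show "\<exists>n. lower_central ?Q n \<subseteq> T" ..
  qed
  then show ?thesis using K(1) by blast
qed

text \<open>Elements of \<open>H\<close> in the same coset of \<open>N\<close> differ by an element
  of \<open>N\<close> and \<open>H\<close>, hence of \<open>K\<close>; so there are no more cosets
  of \<open>K\<close> in \<open>H\<close> than of \<open>N\<close>.\<close>

lemma finite_quotient_if_Int_subset:
  assumes N: "N \<lhd> G" "finite (rcosets N)" and H: "subgroup H G"
    and K: "K \<lhd> (G\<lparr>carrier := H\<rparr>)" "N \<inter> H \<subseteq> K"
  shows "finite (carrier (G\<lparr>carrier := H\<rparr> Mod K))"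
proof -
  let ?H = "G\<lparr>carrier := H\<rparr>"
  interpret HG: group ?H using H is_group by (rule subgroup.subgroup_is_group)
  have Hc: "H \<subseteq> carrier G" using H by (rule subgroup.subset)
  have Ns: "subgroup N G" using N(1) by (rule normal_imp_subgroup)
  have Ks: "subgroup K ?H" using K(1) by (rule normal_imp_subgroup)
  have eq: "K #>\<^bsub>?H\<^esub> a = K #>\<^bsub>?H\<^esub> b" if ab: "a \<in> H" "b \<in> H" "N #> a = N #> b" for a b
  proof -
    have abc: "a \<in> carrier G" "b \<in> carrier G" using ab Hc by blast+
    have "a \<in> N #> b" using rcos_self[OF abc(1) Ns] ab(3) by simp
    then obtain n where n: "n \<in> N" "a = n \<otimes> b" by (auto simp: r_coset_def)
    have nc: "n \<in> carrier G" using n(1) Ns by (rule subgroup.mem_carrier[rotated])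
    have "n = a \<otimes> inv b" using n(2) nc abc by (simp add: m_assoc)
    then have "n \<in> H" using ab H by (simp add: subgroup.m_closed subgroup.m_inv_closed)
    then have "n \<in> K" using n(1) K(2) by blast
    then have "a \<in> K #>\<^bsub>?H\<^esub> b" using n(2) by (auto simp: r_coset_def)
    then show ?thesis using HG.repr_independence[of a K b] ab Ks by simp
  qed
  \<comment> \<open>Cosets of \<open>N\<close> missing \<open>H\<close> get an arbitrary value; it
    suffices that the image covers the quotient.\<close>
  define F where "F C = K #>\<^bsub>?H\<^esub> (SOME a. a \<in> H \<and> N #> a = C)" for C
  have "carrier (?H Mod K) \<subseteq> F ` (rcosets N)"
  proof
    fix C assume "C \<in> carrier (?H Mod K)"
    then obtain a where a: "a \<in> H" "C = K #>\<^bsub>?H\<^esub> a" by (auto simp: carrier_FactGroup)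
    define b where "b = (SOME b. b \<in> H \<and> N #> b = N #> a)"
    have "b \<in> H \<and> N #> b = N #> a" unfolding b_def by (rule someI[of _ a]) (simp add: a(1))
    then have "C = F (N #> a)" using eq[of b a] a by (simp add: F_def b_def)
    moreover have "N #> a \<in> rcosets N" using a(1) Hc by (auto simp: RCOSETS_def)
    ultimately show "C \<in> F ` (rcosets N)" by blast
  qed
  then show ?thesis using N(2) finite_surj by blast
qed

end

section \<open>Finite non-nilpotent images of finitely generated subgroups\<close>

theorem mainTheorem2:
  fixes G :: "('a, 'b) monoid_scheme"
  assumes "group G"
    and "meta_Nil_Hamiltonian G"
    and "soluble_by_finite G"
  shows "W_group G"
  unfolding W_group_def
proof (intro conjI allI impI)
  interpret group G by (rule assms(1))
  show "group G" by (rule assms(1))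
  fix S assume "finite S \<and> S \<subseteq> carrier G \<and> \<not> nilpotent_group (subgroup_generated G S)"
  then have S: "finite S" "S \<subseteq> carrier G" and nn: "\<not> nilpotent_group (subgroup_generated G S)"
    by blast+
  define H where "H = generate G S"
  let ?H = "G\<lparr>carrier := H\<rparr>"
  have sg: "subgroup_generated G S = ?H"
    using S(2) by (simp add: subgroup_generated_def H_def inf_absorb2)
  have H: "subgroup H G" unfolding H_def using S(2) by (rule generate_is_subgroup)
  have SH: "S \<subseteq> H" unfolding H_def by (auto intro: generate.incl)
  interpret H: group ?H using H is_group by (rule subgroup.subgroup_is_group)
  have gen: "generate ?H S = carrier ?H" using generate_consistent[OF SH H] by (simp add: H_def)
  have "\<not> nilpotent_group ?H" using nn sg by simp
  then obtain K where K: "K \<lhd> ?H" and jnn: "just_non_nilpotent (?H Mod K)"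
    using H.exists_just_non_nilpotent_quotient[OF S(1) _ gen] SH by auto
  interpret K: normal K ?H by (rule K)
  let ?Q = "?H Mod K" and ?q = "\<lambda>a. K #>\<^bsub>?H\<^esub> a"
  interpret Q: just_non_nilpotent ?Q by (rule jnn)
  interpret q: group_hom ?H ?Q ?q by (rule K.quotient_group_hom)
  have engel: "engel_normal ?Q"
    using q.engel_normal_image[OF K.quotient_surj]
      H.engel_normal_if_meta_Nil_Hamiltonian[OF meta_Nil_Hamiltonian_subgroup[OF assms(2) H]]
    by blast
  obtain N where N: "N \<lhd> G" "solvable (G\<lparr>carrier := N\<rparr>)" "finite (rcosets\<^bsub>G\<^esub> N)"
    using assms(3) unfolding soluble_by_finite_def by blast
  \<comment> \<open>The inclusion map carries solvability of \<open>N\<close> as a group of its own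
    over to the derived series computed in \<open>G\<close>.\<close>
  have "solvable_seq G (id ` N)"
    using group_hom.solvable_imp_solvable_img[OF canonical_inj_is_hom[OF normal_imp_subgroup[OF N(1)]], of N]
      N(2) by (simp add: solvable_def)
  then obtain m where m: "(derived G ^^ m) N = {\<one>\<^bsub>G\<^esub>}"
    using solvable_imp_trivial_derived_seq by auto
  have D: "(derived G ^^ i) N \<lhd> G" for i
    by (induction i) (simp_all add: N(1) derived_is_normal)
  \<comment> \<open>The first derived term of \<open>N\<close> whose intersection with
    \<open>H\<close> dies in \<open>?Q\<close>.\<close>
  define i where "i = (LEAST i. (derived G ^^ i) N \<inter> H \<subseteq> K)"
  have ex: "(derived G ^^ m) N \<inter> H \<subseteq> K" using m K.one_closed by auto
  have i: "(derived G ^^ i) N \<inter> H \<subseteq> K" unfolding i_def using ex by (rule LeastI)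
  have "finite (carrier ?Q)"
  proof (cases i)
    case 0
    \<comment> \<open>Here \<open>N\<close> itself dies in \<open>?Q\<close>.\<close>
    then show ?thesis using finite_quotient_if_Int_subset[OF N(1,3) H K] i by simp
  next
    case (Suc j)
    \<comment> \<open>The preceding term survives in \<open>?Q\<close>, and commutators of its
      elements lie in the next one, so its image is nontrivial and abelian.\<close>
    let ?D = "(derived G ^^ j) N"
    have "\<not> ?D \<inter> H \<subseteq> K"
      using not_less_Least[of j "\<lambda>i. (derived G ^^ i) N \<inter> H \<subseteq> K"] Suc unfolding i_def by simp
    then obtain y where y: "y \<in> ?D \<inter> H" "y \<notin> K" by blast
    show ?thesis
    proof (rule Q.finite_if_abelian_normal[OF _ _ _ engel])
      have "?D \<inter> H \<lhd> ?H" by (rule normal_Int_subgroup[OF H D])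
      then show "?q ` (?D \<inter> H) \<lhd> ?Q" by (rule q.normal_image[OF K.quotient_surj])
      have "?q y \<noteq> \<one>\<^bsub>?Q\<^esub>" using K.quotient_eq_one_iff[of y] y by simp
      then show "?q ` (?D \<inter> H) \<noteq> {\<one>\<^bsub>?Q\<^esub>}" using y(1) by blast
      fix a b assume "a \<in> ?q ` (?D \<inter> H)" "b \<in> ?q ` (?D \<inter> H)"
      then obtain u v where u: "u \<in> ?D" "u \<in> H" "a = ?q u" and v: "v \<in> ?D" "v \<in> H" "b = ?q v"
        by blast
      let ?c = "u \<otimes>\<^bsub>G\<^esub> v \<otimes>\<^bsub>G\<^esub> inv\<^bsub>G\<^esub> u \<otimes>\<^bsub>G\<^esub> inv\<^bsub>G\<^esub> v"
      have "?c \<in> (derived G ^^ i) N"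
        using u(1) v(1) by (auto simp: Suc derived_def intro!: generate.incl)
      moreover have "?c \<in> H"
        using u(2) v(2) by (intro subgroup.m_closed[OF H] subgroup.m_inv_closed[OF H])
      ultimately have "?c \<in> K" using i by blast
      moreover have "?c = u \<otimes>\<^bsub>?H\<^esub> v \<otimes>\<^bsub>?H\<^esub> inv\<^bsub>?H\<^esub> u \<otimes>\<^bsub>?H\<^esub> inv\<^bsub>?H\<^esub> v"
        using u(2) v(2) H by simp
      ultimately show "a \<otimes>\<^bsub>?Q\<^esub> b = b \<otimes>\<^bsub>?Q\<^esub> a"
        using K.quotient_commute_iff[of u v] u(2,3) v(2,3) by simp
    qed
  qed
  moreover have "\<not> nilpotent_group ?Q"
    using Q.lower_central_nontrivial by (simp add: nilpotent_group_def)
  moreover have "?q \<in> hom ?H ?Q" by (rule K.r_coset_hom_Mod)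
  ultimately show "\<exists>(Q :: 'a set monoid) f. group Q \<and> f \<in> hom (subgroup_generated G S) Q \<and>
      f ` carrier (subgroup_generated G S) = carrier Q \<and> finite (carrier Q) \<and> \<not> nilpotent_group Q"
    unfolding sg using Q.is_group K.quotient_surj by blast
qed

end
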